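(* Let $m\ge 2$ be an integer with $m\equiv 2\pmod 3$, let $f:\mathbb{Z}_3\to\mathbb{Z}_3$, $f(x)=x^m$, and let $t=\nu_3(m+1)$. 1. If $m\equiv 2\pmod 6$, then the minimal decomposition of $\mathbb{Z}_3$ for $f$ is $$\mathbb{Z}_3=\{0,1\}\ \bigsqcup\ \Big(\bigcup_{l\ge0}\ \bigcup_{a=0}^{3^{t-1}-1}M_{l,a}\Big)\ \bigsqcup\ \big((3\mathbb{Z}_3\setminus\{0\})\cup(2+3\mathbb{Z}_3)\big),$$ where $$M_{l,a}=(1+3^{l+1}+3^{l+2}a+3^{t+l+1}\mathbb{Z}_3)\cup\big((1+3^{l+1}+3^{l+2}a)^{-1}+3^{t+l+1}\mathbb{Z}_3\big).$$ Here $\{0,1\}$ is the set of periodic points (all of them fixed points), the $M_{l,a}$ are the minimal components, and $3\mathbb{Z}_3\setminus\{0\}$ and $2+3\mathbb{Z}_3$ are the attracting basins of $0$ and of $1+3\mathbb{Z}_3$, respectively. 2. If $m\equiv 5\pmod 6$, then the minimal decomposition of $\mathbb{Z}_3$ for $f$ is $$\mathbb{Z}_3=\{0,\pm1\}\ \bigsqcup\ \Big(\bigcup_{l\ge0}\ \bigcup_{a=0}^{3^{t-1}-1}\ \bigcup_{i=1}^{2}M_{l,a,i}\Big)\ \bigsqcup\ (3\mathbb{Z}_3\setminus\{0\}),$$ where $$M_{l,a,1}=(1+3^{l+1}+3^{l+2}a+3^{t+l+1}\mathbb{Z}_3)\cup\big((1+3^{l+1}+3^{l+2}a)^{-1}+3^{t+l+1}\mathbb{Z}_3\big),$$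 $$M_{l,a,2}=(-1+3^{l+1}+3^{l+2}a+3^{t+l+1}\mathbb{Z}_3)\cup\big((-1+3^{l+1}+3^{l+2}a)^{-1}+3^{t+l+1}\mathbb{Z}_3\big).$$ Here $\{0,\pm1\}$ is the set of periodic points (all of them fixed points), the $M_{l,a,i}$ are the minimal components, and $3\mathbb{Z}_3\setminus\{0\}$ is the attracting basin of the fixed point $0$.
   Context: $\mathbb{Z}_3$ is the ring of $3$-adic integers with its $3$-adic metric, and $\nu_3$ is the $3$-adic valuation; inverses are taken in $\mathbb{Z}_3$. For a polynomial $f$ over $\mathbb{Z}_p$, a minimal decomposition of $\mathbb{Z}_p$ for $f$ is a partition $\mathbb{Z}_p=\mathcal{P}\sqcup\mathcal{M}\sqcup\mathcal{B}$ where (1) $\mathcal{P}$ is the set of all periodic points of $f$; (2) $\mathcal{M}=\bigsqcup_i\mathcal{M}_i$ is a disjoint union of at most countably many clopen $f$-invariant sets, each a finite union of balls, such that each subsystem $f:\mathcal{M}_i\to\mathcal{M}_i$ is minimal (every forward orbit in $\mathcal{M}_i$ is dense in $\mathcal{M}_i$); the $\mathcal{M}_i$ are called minimal components; (3) each point of $\mathcal{B}$ lies in the attracting basin of a periodic orbit or of a minimal component. A point $x$ lies in the attracting basin of a closed invariant set $A$ if the distance from $f^n(x)$ to $A$ tends to $0$ as $n\to\infty$; in describing $\mathcal{B}$, the attracting set itself is not listed as part of its basin. *)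

theory Defs
  imports "HOL-Analysis.Analysis" "HOL-Number_Theory.Cong"
begin

(* The ring of 3-adic integers as the inverse limit of the rings Z/3^n; the n-th component of
   an element is represented by its least nonnegative residue. *)

typedef z3 = "{r :: nat \<Rightarrow> int. \<forall>n. 0 \<le> r n \<and> r n < 3 ^ n \<and> r (Suc n) mod 3 ^ n = r n}"
  morphisms res Abs_z3
  by (rule exI[of _ "\<lambda>_. 0"]) simp

setup_lifting type_definition_z3

lemma res_mod [simp]: "res x n mod 3 ^ n = res x n"
  using res[of x] by (auto intro: mod_pos_pos_trivial)

lemma res_Suc_mod [simp]: "res x (Suc n) mod 3 ^ n = res x n"
  using res[of x] by auto

lemma res_bounds: "0 \<le> res x n" "res x n < 3 ^ n"
  using res[of x] by auto

lemma z3_eqI: "(\<And>n. res x n = res y n) \<Longrightarrow> x = y"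
  by (metis ext res_inject)

lemma mod_pow_Suc: "(a mod 3 ^ Suc n) mod 3 ^ n = a mod (3::int) ^ n"
  by (rule mod_mod_cancel) simp

lemma coherentI:
  fixes a b :: int
  assumes "a mod 3 ^ n = b mod 3 ^ n"
  shows "0 \<le> b mod 3 ^ n \<and> b mod 3 ^ n < 3 ^ n \<and> a mod 3 ^ Suc n mod 3 ^ n = b mod 3 ^ n"
  unfolding mod_pow_Suc by (simp add: assms)

instantiation z3 :: comm_ring_1
begin

lift_definition zero_z3 :: z3 is "\<lambda>_. 0" by simp

lift_definition one_z3 :: z3 is "\<lambda>n. 1 mod 3 ^ n"
  by (rule coherentI) simp

lift_definition plus_z3 :: "z3 \<Rightarrow> z3 \<Rightarrow> z3" is "\<lambda>r s n. (r n + s n) mod 3 ^ n"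
  by (rule coherentI) (metis mod_add_eq)

lift_definition times_z3 :: "z3 \<Rightarrow> z3 \<Rightarrow> z3" is "\<lambda>r s n. (r n * s n) mod 3 ^ n"
  by (rule coherentI) (metis mod_mult_eq)

lift_definition uminus_z3 :: "z3 \<Rightarrow> z3" is "\<lambda>r n. (- r n) mod 3 ^ n"
  by (rule coherentI) (metis mod_minus_eq)

lift_definition minus_z3 :: "z3 \<Rightarrow> z3 \<Rightarrow> z3" is "\<lambda>r s n. (r n - s n) mod 3 ^ n"
  by (rule coherentI) (metis mod_diff_eq)

instance
proof
  fix a b c :: z3
  show "a * b * c = a * (b * c)"
    by (rule z3_eqI) (simp add: times_z3.rep_eq mod_simps mult.assoc)
  show "a * b = b * a"
    by (rule z3_eqI) (simp add: times_z3.rep_eq mult.commute)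
  show "1 * a = a"
    by (rule z3_eqI) (simp add: times_z3.rep_eq one_z3.rep_eq mod_simps)
  show "a + b + c = a + (b + c)"
    by (rule z3_eqI) (simp add: plus_z3.rep_eq mod_simps add.assoc)
  show "a + b = b + a"
    by (rule z3_eqI) (simp add: plus_z3.rep_eq add.commute)
  show "0 + a = a"
    by (rule z3_eqI) (simp add: plus_z3.rep_eq zero_z3.rep_eq)
  show "- a + a = 0"
    by (rule z3_eqI) (simp add: plus_z3.rep_eq uminus_z3.rep_eq zero_z3.rep_eq mod_simps)
  show "a - b = a + - b"
    by (rule z3_eqI) (simp add: plus_z3.rep_eq uminus_z3.rep_eq minus_z3.rep_eq mod_simps)
  show "(a + b) * c = a * c + b * c"
    by (rule z3_eqI) (simp add: plus_z3.rep_eq times_z3.rep_eq mod_simps distrib_right)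
  have "res (0 :: z3) 1 \<noteq> res 1 1"
    by (simp add: zero_z3.rep_eq one_z3.rep_eq)
  then show "(0 :: z3) \<noteq> 1" by metis
qed

end

lemma res_of_nat: "res (of_nat k) n = int k mod 3 ^ n"
  by (induction k) (simp_all add: zero_z3.rep_eq plus_z3.rep_eq one_z3.rep_eq mod_simps)

lemma res_three_power: "res (3 ^ k) n = 3 ^ k mod 3 ^ n"
  using res_of_nat[of "3 ^ k" n] by simp

lemma res_mod_le: "k \<le> n \<Longrightarrow> res x n mod 3 ^ k = res x k"
proof (induction n rule: dec_induct)
  case base
  show ?case by simp
next
  case (step n)
  have "res x (Suc n) mod 3 ^ k = (res x (Suc n) mod 3 ^ n) mod 3 ^ k"
    using step by (intro mod_mod_cancel [symmetric] le_imp_power_dvd) auto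
  then show ?case using step by simp
qed

lemma three_power_dvd_iff: "3 ^ k dvd x \<longleftrightarrow> res x k = 0"
proof
  assume "3 ^ k dvd x"
  then obtain y where "x = 3 ^ k * y" by (elim dvdE)
  then show "res x k = 0" by (simp add: times_z3.rep_eq res_three_power)
next
  assume x: "res x k = 0"
  define r where "r = (\<lambda>n. res x (k + n) div 3 ^ k)"
  have x_eq: "res x (k + n) = 3 ^ k * r n" for n
  proof -
    have "res x (k + n) mod 3 ^ k = 0" using res_mod_le[of k "k + n" x] x by simp
    then have "3 ^ k dvd res x (k + n)" by (simp add: dvd_eq_mod_eq_0)
    then show ?thesis by (simp add: r_def)
  qed
  have "0 \<le> r n \<and> r n < 3 ^ n \<and> r (Suc n) mod 3 ^ n = r n" for n
  proof (intro conjI)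
    show "0 \<le> r n" by (simp add: r_def res_bounds pos_imp_zdiv_nonneg_iff)
    have "3 ^ k * r n < 3 ^ k * 3 ^ n"
      using res_bounds(2)[of x "k + n"] by (simp add: x_eq power_add)
    then show "r n < 3 ^ n" by simp
    have "3 ^ k * (r (Suc n) mod 3 ^ n) = res x (k + Suc n) mod (3 ^ (k + n))"
      unfolding x_eq power_add by (rule mult_mod_right)
    also have "\<dots> = res x (k + n)" by (rule res_mod_le) simp
    also have "\<dots> = 3 ^ k * r n" by (rule x_eq)
    finally show "r (Suc n) mod 3 ^ n = r n" by simp
  qed
  then have r: "res (Abs_z3 r) = r" by (intro Abs_z3_inverse) simp
  have "x = 3 ^ k * Abs_z3 r"
  proof (rule z3_eqI)
    fix n
    have "res (3 ^ k * Abs_z3 r) n = (3 ^ k mod 3 ^ n) * r n mod 3 ^ n"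
      by (simp only: times_z3.rep_eq res_three_power r)
    also have "\<dots> = res x (k + n) mod 3 ^ n"
      unfolding x_eq by (rule mod_mult_left_eq)
    also have "\<dots> = res x n" by (simp add: res_mod_le)
    finally show "res x n = res (3 ^ k * Abs_z3 r) n" ..
  qed
  then show "3 ^ k dvd x" by simp
qed

(* The 3-adic valuation; its value at 0 (where it should be infinite) is irrelevant. *)
definition z3_val :: "z3 \<Rightarrow> nat" where
  "z3_val x = (GREATEST n. 3 ^ n dvd x)"

definition z3_abs :: "z3 \<Rightarrow> real" where
  "z3_abs x = (if x = 0 then 0 else 1 / 3 ^ z3_val x)"

lemma z3_dvd_bounded:
  fixes x :: z3
  assumes "x \<noteq> 0"
  shows "\<exists>N. \<forall>n. 3 ^ n dvd x \<longrightarrow> n \<le> N"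
proof -
  obtain N where N: "res x N \<noteq> 0"
    using assms z3_eqI[of x 0] by (auto simp: zero_z3.rep_eq)
  have "n \<le> N" if "3 ^ n dvd x" for n
  proof (rule ccontr)
    assume "\<not> n \<le> N"
    then have "3 ^ N dvd x" using that by (meson dvd_trans le_imp_power_dvd nat_le_linear)
    with N show False by (simp add: three_power_dvd_iff)
  qed
  then show ?thesis by blast
qed

lemma three_power_dvd_iff_val:
  fixes x :: z3
  assumes "x \<noteq> 0"
  shows "3 ^ n dvd x \<longleftrightarrow> n \<le> z3_val x"
proof -
  obtain N where N: "\<And>n. 3 ^ n dvd x \<Longrightarrow> n \<le> N" using z3_dvd_bounded[OF assms] by blast
  have "3 ^ z3_val x dvd x"
    unfolding z3_val_def by (rule GreatestI_nat[of "\<lambda>n. 3 ^ n dvd x" 0]) (auto intro: N)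
  moreover have "n \<le> z3_val x" if "3 ^ n dvd x"
    unfolding z3_val_def by (rule Greatest_le_nat[of "\<lambda>n. 3 ^ n dvd x"]) (auto intro: N that)
  ultimately show ?thesis by (meson dvd_trans le_imp_power_dvd)
qed

lemma z3_abs_le_iff: "z3_abs x \<le> 1 / 3 ^ n \<longleftrightarrow> 3 ^ n dvd x"
  by (auto simp: z3_abs_def three_power_dvd_iff_val field_simps)

lemma z3_abs_minus: "z3_abs (- x) = z3_abs x"
  by (simp add: z3_abs_def z3_val_def)

lemma z3_abs_ultrametric: "z3_abs (x + y) \<le> max (z3_abs x) (z3_abs y)"
proof (cases "x = 0 \<or> y = 0")
  case True
  then show ?thesis by auto
next
  case False
  have le: "z3_abs (u + v) \<le> z3_abs v" if "u \<noteq> 0" "v \<noteq> 0" "z3_val v \<le> z3_val u" for u v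
  proof -
    have "3 ^ z3_val v dvd u + v"
      using that by (intro dvd_add) (simp_all add: three_power_dvd_iff_val)
    then show ?thesis using that by (simp add: z3_abs_def[of v] z3_abs_le_iff)
  qed
  show ?thesis
    using le[of x y] le[of y x] False by (cases "z3_val y \<le> z3_val x") (auto simp: add.commute)
qed

instantiation z3 :: metric_space
begin

definition dist_z3 :: "z3 \<Rightarrow> z3 \<Rightarrow> real" where
  "dist_z3 x y = z3_abs (x - y)"

definition uniformity_z3 :: "(z3 \<times> z3) filter" where
  "uniformity_z3 = (INF e\<in>{0<..}. principal {(x, y). dist x y < e})"

definition open_z3 :: "z3 set \<Rightarrow> bool" where
  "open_z3 U \<longleftrightarrow> (\<forall>x\<in>U. eventually (\<lambda>(x', y). x' = x \<longrightarrow> y \<in> U) uniformity)"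

instance
proof
  fix x y z :: z3
  show "dist x y = 0 \<longleftrightarrow> x = y" by (simp add: dist_z3_def z3_abs_def)
  have "z3_abs (x - y) \<le> max (z3_abs (x - z)) (z3_abs (- (y - z)))"
    using z3_abs_ultrametric[of "x - z" "- (y - z)"] by simp
  also have "\<dots> \<le> z3_abs (x - z) + z3_abs (y - z)"
    unfolding z3_abs_minus by (auto simp: z3_abs_def)
  finally show "dist x y \<le> dist x z + dist y z" by (simp add: dist_z3_def)
qed (simp_all add: uniformity_z3_def open_z3_def)

end

(* The ball c + 3^n Z_3. *)
definition z3_coset :: "z3 \<Rightarrow> nat \<Rightarrow> z3 set" where
  "z3_coset c n = {c + 3 ^ n * z | z. True}"

(* Meaningful only for units, where the inverse exists and is unique. *)
definition unit_inverse :: "'a::comm_ring_1 \<Rightarrow> 'a" where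
  "unit_inverse u = (THE v. u * v = 1)"

definition periodic_points :: "('a \<Rightarrow> 'a) \<Rightarrow> 'a set" where
  "periodic_points f = {x. \<exists>n>0. (f ^^ n) x = x}"

definition forward_orbit :: "('a \<Rightarrow> 'a) \<Rightarrow> 'a \<Rightarrow> 'a set" where
  "forward_orbit f x = {(f ^^ n) x | n. True}"

(* Nonemptiness is required because infdist to the empty set is 0 by convention. *)
definition attracting_basin :: "('a::metric_space \<Rightarrow> 'a) \<Rightarrow> 'a set \<Rightarrow> 'a set" where
  "attracting_basin f A =
     {x. A \<noteq> {} \<and> closed A \<and> f ` A \<subseteq> A \<and> (\<lambda>n. infdist ((f ^^ n) x) A) \<longlonglongrightarrow> 0}"

definition finite_union_of_balls :: "'a::metric_space set \<Rightarrow> bool" where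
  "finite_union_of_balls A \<longleftrightarrow>
     (\<exists>F. finite F \<and> (\<forall>S\<in>F. \<exists>c r. r > 0 \<and> S = cball c r) \<and> A = \<Union>F)"

definition minimal_component :: "('a::metric_space \<Rightarrow> 'a) \<Rightarrow> 'a set \<Rightarrow> bool" where
  "minimal_component f A \<longleftrightarrow>
     A \<noteq> {} \<and> open A \<and> closed A \<and> f ` A \<subseteq> A \<and> finite_union_of_balls A \<and>
     (\<forall>x\<in>A. A \<subseteq> closure (forward_orbit f x))"

(* The middle part of the decomposition is given as the family M of its minimal components,
   indexed by I. *)
definition minimal_decomposition ::
    "('a::metric_space \<Rightarrow> 'a) \<Rightarrow> 'a set \<Rightarrow> 'i set \<Rightarrow> ('i \<Rightarrow> 'a set) \<Rightarrow> 'a set \<Rightarrow> bool" where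
  "minimal_decomposition f P I M B \<longleftrightarrow>
     UNIV = P \<union> (\<Union>i\<in>I. M i) \<union> B \<and>
     P \<inter> (\<Union>i\<in>I. M i) = {} \<and> P \<inter> B = {} \<and> (\<Union>i\<in>I. M i) \<inter> B = {} \<and>
     P = periodic_points f \<and>
     countable I \<and> disjoint_family_on M I \<and> (\<forall>i\<in>I. minimal_component f (M i)) \<and>
     (\<forall>x\<in>B. (\<exists>p\<in>P. x \<in> attracting_basin f (forward_orbit f p)) \<or>
             (\<exists>i\<in>I. x \<in> attracting_basin f (M i)))"

(* M_comp 1 t l a is M_{l,a} (and M_{l,a,1}); M_comp (-1) t l a is M_{l,a,2}. *)
definition M_comp :: "z3 \<Rightarrow> nat \<Rightarrow> nat \<Rightarrow> nat \<Rightarrow> z3 set" where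
  "M_comp e t l a =
     z3_coset (e + 3 ^ (l + 1) + 3 ^ (l + 2) * of_nat a) (t + l + 1) \<union>
     z3_coset (unit_inverse (e + 3 ^ (l + 1) + 3 ^ (l + 2) * of_nat a)) (t + l + 1)"

end

theory Submission
  imports Defs
begin

text \<open>Since \<open>m + 1\<close> has valuation \<open>t\<close>, a point \<open>x\<close> at distance exactly \<open>3\<^sup>-\<^sup>k\<close> from
  \<open>e = 1\<close> or \<open>e = -1\<close> satisfies \<open>x\<^sup>m \<equiv> x\<^sup>-\<^sup>1\<close> modulo \<open>3\<^sup>t\<^sup>+\<^sup>k\<close>, so \<open>f\<close> preserves each class of congruence up to
  inversion modulo \<open>3\<^sup>t\<^sup>+\<^sup>k\<close>. Lifting the exponent twice, first for \<open>m\<^sup>2\<close> and then for \<open>x\<close>, shows that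
  \<open>f\<^sup>2\<^sup>j(x) \<equiv> x\<close> modulo \<open>3\<^sup>t\<^sup>+\<^sup>k\<^sup>+\<^sup>r\<close> exactly when \<open>3\<^sup>r\<close> divides \<open>j\<close>. Hence the only periodic point near \<open>e\<close>
  is \<open>e\<close> itself; and an iterate approximating \<open>y\<close> modulo \<open>3\<^sup>t\<^sup>+\<^sup>k\<^sup>+\<^sup>r\<close> yields, by applying \<open>f\<close> a further 0, \<open>2 * 3\<^sup>r\<close> or
  \<open>4 * 3\<^sup>r\<close> times, three points that are pairwise incongruent modulo the next power of 3, so one of them
  approximates \<open>y\<close> one step better. This gives minimality.\<close>

section \<open>Lifting the exponent at 3\<close>

lemma three_power_dvd_of_power_dvd:
  fixes a :: "'a::comm_ring_1"
  assumes "3 ^ k dvd a - 1" and "k > 0"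
  shows "3 ^ (k + r) dvd a ^ (3 ^ r) - 1"
proof (induction r)
  case 0
  then show ?case using assms by simp
next
  case (Suc r)
  define b where "b = a ^ (3 ^ r)"
  obtain v where v: "b - 1 = 3 ^ (k + r) * v" using Suc by (auto simp: b_def elim: dvdE)
  have "3 dvd b - 1" using v assms(2) by (cases k) auto
  then obtain w where w: "b = 1 + 3 * w" by (metis add.commute diff_add_cancel dvdE)
  have "b ^ 3 - 1 = (b - 1) * (b ^ 2 + b + 1)"
    by (simp add: algebra_simps power2_eq_square power3_eq_cube)
  \<comment> \<open>As \<open>b\<close> is 1 modulo 3, the cofactor is 1 + 1 + 1 modulo 3; each
    cubing therefore gains a factor 3.\<close>
  also have "b ^ 2 + b + 1 = 3 * (1 + 3 * w + 3 * w ^ 2)"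
    unfolding w by (simp add: algebra_simps power2_eq_square)
  finally have "b ^ 3 - 1 = 3 ^ (k + Suc r) * (v * (1 + 3 * w + 3 * w ^ 2))"
    by (simp add: v algebra_simps)
  then show ?case by (simp add: b_def flip: power_mult) (simp add: mult.commute)
qed

text \<open>Only the remainder modulo 3 matters, and a prime element 3 divides neither 1 nor 2 = 3 -
  1. This links the exponent, a natural number, to its image as a coefficient in the ring.\<close>

lemma three_dvd_of_nat_iff:
  fixes n :: nat
  assumes "prime_elem (3 :: 'a::idom)"
  shows "(3 :: 'a) dvd of_nat n \<longleftrightarrow> 3 dvd n"
proof
  assume "3 dvd n"
  then show "(3 :: 'a) dvd of_nat n" by (auto elim!: dvdE)
next
  assume d: "(3 :: 'a) dvd of_nat n"
  have n1: "\<not> (3 :: 'a) dvd 1" using assms by (simp add: prime_elem_def)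
  have n2: "\<not> (3 :: 'a) dvd 2"
  proof
    assume "(3 :: 'a) dvd 2"
    then have "(3 :: 'a) dvd 3 - 2" by (intro dvd_diff) auto
    with n1 show False by simp
  qed
  have "of_nat n = 3 * of_nat (n div 3) + (of_nat (n mod 3) :: 'a)"
    by (metis mult_div_mod_eq of_nat_add of_nat_mult of_nat_numeral)
  with d have "(3 :: 'a) dvd of_nat (n mod 3)"
    by (metis dvd_add_right_iff dvd_triv_left)
  moreover have "n mod 3 = 0 \<or> n mod 3 = 1 \<or> n mod 3 = 2" by auto
  ultimately show "3 dvd n" using n1 n2 by auto
qed

text \<open>The lifting-the-exponent lemma at 3, phrased without valuations.\<close>

lemma three_power_dvd_power_minus_one_iff:
  fixes a :: "'a::idom"
  assumes "prime_elem (3 :: 'a)" "k > 0" "3 ^ k dvd a - 1" "\<not> 3 ^ Suc k dvd a - 1"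
  shows "3 ^ (k + r) dvd a ^ n - 1 \<longleftrightarrow> 3 ^ r dvd n"
  using assms(2-)
proof (induction r arbitrary: a k n)
  case 0
  have "a - 1 dvd a ^ n - 1"
    using power_diff_sumr2[of a n 1] by simp
  then show ?case using 0 by (auto intro: dvd_trans)
next
  case (Suc r)
  obtain u where u: "a = 1 + 3 ^ k * u"
    using Suc.prems(2) by (metis add.commute diff_add_cancel dvdE)
  have p3: "(3 :: 'a) \<noteq> 0" using assms(1) by auto
  have nu: "\<not> 3 dvd u" using Suc.prems(3) by (auto simp: u mult.commute)
  obtain k' where k': "k = Suc k'" using Suc.prems(1) by (cases k) auto
  \<comment> \<open>First-order binomial expansion: the further terms carry
    \<open>3 ^ (2 * k)\<close>, which \<open>k > 0\<close> makes divisible by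
    \<open>3 ^ Suc k\<close>; hence the factor 3 in front of \<open>w\<close>.\<close>
  have expand: "\<exists>w. a ^ n = 1 + 3 ^ k * (of_nat n * u + 3 * w)" for n
  proof (induction n)
    case 0
    then show ?case by (intro exI[of _ 0]) simp
  next
    case (Suc n)
    then obtain w where "a ^ n = 1 + 3 ^ k * (of_nat n * u + 3 * w)" by blast
    then have "a ^ Suc n = 1 + 3 ^ k * (of_nat (Suc n) * u
        + 3 * (w + 3 ^ k' * u * (of_nat n * u + 3 * w)))"
      by (simp add: u k' algebra_simps)
    then show ?case by blast
  qed
  \<comment> \<open>If 3 divides \<open>n\<close>, pass to \<open>a ^ 3\<close>, which sits exactly
    at level \<open>k + 1\<close>, with exponent \<open>q\<close> and one less in \<open>r\<close>.
    Otherwise \<open>a ^ n\<close> stays exactly at level \<open>k\<close>.\<close>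
  show ?case
  proof (cases "3 dvd n")
    case True
    then obtain q where q: "n = 3 * q" by blast
    \<comment> \<open>Relative to \<open>3 ^ k\<close>, the quadratic and cubic terms carry a factor
      9 because \<open>k > 0\<close>, so they cannot disturb the leading term
      \<open>3 * u\<close>.\<close>
    obtain w where w: "a ^ 3 - 1 = 3 ^ k * (3 * u + 9 * w)"
    proof -
      have "a ^ 3 - 1 = 3 ^ k * (3 * u + 9 * (3 ^ k' * u ^ 2 + 3 ^ k' * 3 ^ k' * u ^ 3))"
        by (simp add: u k' power3_eq_cube power2_eq_square algebra_simps)
      then show thesis by (rule that)
    qed
    have "a ^ 3 - 1 = 3 ^ Suc k * (u + 3 * w)" by (simp add: w algebra_simps)
    moreover have "\<not> 3 dvd u + 3 * w" using nu by (simp add: dvd_add_left_iff)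
    ultimately have "3 ^ Suc k dvd a ^ 3 - 1" "\<not> 3 ^ Suc (Suc k) dvd a ^ 3 - 1"
      using p3 by (simp_all only: power_Suc2 [of 3 "Suc k"] dvd_mult_cancel_left dvd_triv_left) simp_all
    from Suc.IH[OF _ this, of q] show ?thesis by (simp add: q power_mult)
  next
    case False
    obtain w where w: "a ^ n = 1 + 3 ^ k * (of_nat n * u + 3 * w)" using expand by blast
    have "\<not> 3 dvd of_nat n * u"
      using False nu assms(1) by (simp add: prime_elem_dvd_mult_iff three_dvd_of_nat_iff)
    then have "\<not> 3 dvd of_nat n * u + 3 * w" by (simp add: dvd_add_left_iff)
    then have "\<not> 3 ^ k * 3 dvd a ^ n - 1" using p3 by (simp add: w)
    moreover have "(3 :: 'a) ^ k * 3 dvd 3 ^ (k + Suc r)" by (simp add: power_add mult.left_commute mult_dvd_mono)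
    ultimately have "\<not> 3 ^ (k + Suc r) dvd a ^ n - 1" by (meson dvd_trans)
    moreover have "\<not> 3 ^ Suc r dvd n" using False by (auto dest: dvd_mult_left)
    ultimately show ?thesis by simp
  qed
qed

section \<open>The 3-adic integers as an integral domain, and their units\<close>

lemma z3_three_mult_eq_0_iff: "3 * x = 0 \<longleftrightarrow> x = (0 :: z3)"
proof
  assume x: "3 * x = 0"
  show "x = 0"
  proof (rule z3_eqI)
    fix n
    \<comment> \<open>Dividing by 3 costs one digit, so component \<open>n\<close> of
      \<open>x\<close> is read off from component \<open>Suc n\<close> of
      \<open>3 * x\<close>.\<close>
    have "res (3 * x) (Suc n) = 3 * res x (Suc n) mod 3 ^ Suc n"
      using res_of_nat[of 3 "Suc n"] by (simp add: times_z3.rep_eq mod_simps)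
    then have "3 * 3 ^ n dvd 3 * res x (Suc n)"
      by (simp only: x zero_z3.rep_eq eq_commute[of 0] mod_eq_0_iff_dvd power_Suc)
    then have "3 ^ n dvd res x (Suc n)" by (metis dvd_mult_cancel_left zero_neq_numeral)
    then have "res x (Suc n) mod 3 ^ n = 0" by (simp only: mod_eq_0_iff_dvd)
    then show "res x n = res 0 n" by (simp add: zero_z3.rep_eq)
  qed
qed simp

lemma z3_three_dvd_iff: "3 dvd x \<longleftrightarrow> res x 1 = 0"
  using three_power_dvd_iff[of 1 x] by simp

lemma z3_mod_three_cases:
  fixes x :: z3
  obtains "3 dvd x" | "3 dvd x - 1" | "3 dvd x - 2"
proof -
  have "res x 1 = 0 \<or> res x 1 = 1 \<or> res x 1 = 2"
    using res_bounds[of x 1] by auto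
  moreover have "res 2 1 = 2" using res_of_nat[of 2 1] by simp
  ultimately show thesis using that
    by (auto simp: z3_three_dvd_iff minus_z3.rep_eq one_z3.rep_eq)
qed

lemma z3_three_dvd_mult_iff: "3 dvd x * y \<longleftrightarrow> 3 dvd x \<or> 3 dvd (y :: z3)"
proof -
  have "res x 1 = 0 \<or> res x 1 = 1 \<or> res x 1 = 2" "res y 1 = 0 \<or> res y 1 = 1 \<or> res y 1 = 2"
    using res_bounds[of x 1] res_bounds[of y 1] by auto
  then show ?thesis by (auto simp: z3_three_dvd_iff times_z3.rep_eq)
qed

lemma z3_three_power_cancel: "3 ^ k * x = 0 \<longleftrightarrow> x = (0 :: z3)"
  by (induction k) (simp_all add: mult.assoc z3_three_mult_eq_0_iff)

lemma z3_factor: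
  fixes x :: z3
  assumes "x \<noteq> 0"
  obtains u where "x = 3 ^ z3_val x * u" "\<not> 3 dvd u"
proof -
  obtain u where u: "x = 3 ^ z3_val x * u"
    using three_power_dvd_iff_val[OF assms, of "z3_val x"] by (auto elim: dvdE)
  have "\<not> 3 dvd u"
  proof
    assume "3 dvd u"
    then have "3 ^ z3_val x * 3 dvd 3 ^ z3_val x * u" by (rule mult_dvd_mono[OF dvd_refl])
    then have "3 ^ Suc (z3_val x) dvd x" using u by (simp add: mult.commute)
    then show False using three_power_dvd_iff_val[OF assms, of "Suc (z3_val x)"] by simp
  qed
  with u show thesis by (rule that)
qed

instance z3 :: idom
proof
  fix x y :: z3
  assume "x \<noteq> 0" "y \<noteq> 0"
  then obtain u v where u: "x = 3 ^ z3_val x * u" "\<not> 3 dvd u"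
    and v: "y = 3 ^ z3_val y * v" "\<not> 3 dvd v" by (meson z3_factor)
  \<comment> \<open>The unit parts multiply to a non-multiple of 3, in particular to something
    nonzero, and powers of 3 can be cancelled.\<close>
  have "u * v \<noteq> 0" using u v z3_three_dvd_mult_iff[of u v] by auto
  then have "3 ^ (z3_val x + z3_val y) * (u * v) \<noteq> 0"
    by (simp only: z3_three_power_cancel not_False_eq_True)
  moreover have "x * y = 3 ^ (z3_val x + z3_val y) * (u * v)"
    by (subst u(1), subst v(1)) (simp add: power_add mult_ac)
  ultimately show "x * y \<noteq> 0" by simp
qed

lemma z3_three_neq_0 [simp]: "(3 :: z3) \<noteq> 0"
  using z3_three_mult_eq_0_iff[of 1] by simp

lemma z3_not_three_dvd_one [simp]: "\<not> (3 :: z3) dvd 1"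
  by (simp add: z3_three_dvd_iff one_z3.rep_eq)

lemma prime_elem_three_z3: "prime_elem (3 :: z3)"
  by (rule prime_elemI) (auto simp: z3_three_dvd_mult_iff)

lemma z3_three_power_dvd_mult_iff:
  fixes x y :: z3
  assumes "\<not> 3 dvd x"
  shows "3 ^ n dvd x * y \<longleftrightarrow> 3 ^ n dvd y"
proof
  show "3 ^ n dvd x * y \<Longrightarrow> 3 ^ n dvd y"
  proof (induction n arbitrary: y)
    case (Suc n)
    then have "3 dvd x * y" by (auto intro: dvd_mult_left)
    then obtain z where z: "y = 3 * z" using assms by (auto simp: z3_three_dvd_mult_iff)
    then have "3 ^ n dvd x * z" using Suc.prems by (simp add: mult.left_commute)
    with Suc.IH[of z] show ?case by (simp add: z)
  qed simp
qed simp

lemma z3_not_three_dvd_power: "\<not> 3 dvd x \<Longrightarrow> \<not> 3 dvd (x :: z3) ^ n"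
  by (metis prime_elem_dvd_power prime_elem_three_z3)

text \<open>A unit has square 1 modulo 3, so \<open>x ^ (2 * 3 ^ n)\<close> tends to 1 and the
  powers \<open>x ^ (2 * 3 ^ n - 1)\<close> are inverses modulo \<open>3 ^ n\<close>. Their residues
  are glued to an exact inverse.\<close>

lemma z3_unit_inverse:
  fixes x :: z3
  assumes "\<not> 3 dvd x"
  shows "x * unit_inverse x = 1"
proof -
  have sq: "3 ^ 1 dvd x ^ 2 - 1"
  proof (cases rule: z3_mod_three_cases[of x])
    case 2
    then have "3 dvd (x - 1) * (x + 1)" by simp
    then show ?thesis by (simp add: algebra_simps power2_eq_square)
  next
    case 3
    then have "3 dvd (x - 2) + 3" by (rule dvd_add) simp
    then have "3 dvd (x - 1) * (x + 1)" by (simp add: add.commute)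
    then show ?thesis by (simp add: algebra_simps power2_eq_square)
  qed (use assms in simp)
  have one: "3 ^ n dvd (x ^ 2) ^ (3 ^ n) - 1" for n
    using three_power_dvd_of_power_dvd[OF sq, of n] by (meson dvd_trans le_imp_power_dvd le_add2 zero_less_one)
  define p where "p n = x * (x ^ 2) ^ (3 ^ n - 1)" for n :: nat
  have xp: "x * p n = (x ^ 2) ^ (3 ^ n)" for n
    using power_minus_mult[of "3 ^ n" "x ^ 2"] by (simp add: p_def power2_eq_square mult_ac)
  have xp1: "3 ^ n dvd x * p n - 1" for n
    unfolding xp by (rule one)
  \<comment> \<open>Two inverses modulo \<open>3 ^ n\<close> agree modulo \<open>3 ^ n\<close>,
    since the unit \<open>x\<close> can be cancelled.\<close>
  have coh: "res (p (Suc n)) n = res (p n) n" for n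
  proof -
    have "3 ^ n dvd x * p (Suc n) - 1"
      using xp1[of "Suc n"] by (metis dvd_mult_right power_Suc)
    then have "3 ^ n dvd (x * p (Suc n) - 1) - (x * p n - 1)" using xp1 by (rule dvd_diff)
    then have "3 ^ n dvd x * (p (Suc n) - p n)" by (simp add: algebra_simps)
    then have "res (p (Suc n) - p n) n = 0"
      by (simp only: z3_three_power_dvd_mult_iff[OF assms] flip: three_power_dvd_iff)
    then have "res (p (Suc n)) n mod 3 ^ n = res (p n) n mod 3 ^ n"
      by (simp only: minus_z3.rep_eq mod_eq_dvd_iff mod_eq_0_iff_dvd)
    then show ?thesis by simp
  qed
  define y where "y = Abs_z3 (\<lambda>n. res (p n) n)"
  have y: "res y n = res (p n) n" for n
    unfolding y_def by (subst Abs_z3_inverse) (auto simp: res_bounds coh)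
  have "x * y = 1"
  proof (rule z3_eqI)
    fix n
    have "res (x * p n - 1) n = 0" using xp1 by (simp add: three_power_dvd_iff)
    then have "res (x * p n) n mod 3 ^ n = res 1 n mod 3 ^ n"
      by (simp only: minus_z3.rep_eq mod_eq_dvd_iff mod_eq_0_iff_dvd)
    then show "res (x * y) n = res 1 n" by (simp add: times_z3.rep_eq y)
  qed
  \<comment> \<open>Uniqueness gives the definite description in \<open>unit_inverse\<close> its
    value.\<close>
  moreover have "v = y" if "x * v = 1" for v
    using that \<open>x * y = 1\<close> by (metis mult.assoc mult.commute mult_1)
  ultimately show ?thesis unfolding unit_inverse_def by (metis (mono_tags, lifting) theI)
qed

lemma z3_not_three_dvd_of_sq_eq_one: "e * e = 1 \<Longrightarrow> \<not> 3 dvd (e :: z3)"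
  by (metis dvd_mult z3_not_three_dvd_one)

lemma z3_not_three_dvd_of_cong: "\<not> 3 dvd y \<Longrightarrow> 3 dvd x - y \<Longrightarrow> \<not> 3 dvd (x :: z3)"
  by (metis diff_diff_eq2 add_diff_cancel_left' dvd_diff)

text \<open>Three elements pairwise incongruent modulo 3 exhaust the residues, so one of them has
  residue 0.\<close>

lemma z3_three_pigeonhole:
  fixes u v w :: z3
  shows "3 dvd u \<or> 3 dvd v \<or> 3 dvd w \<or> 3 dvd v - u \<or> 3 dvd w - u \<or> 3 dvd w - v"
proof -
  have "res x 1 = 0 \<or> res x 1 = 1 \<or> res x 1 = 2" for x
    using res_bounds[of x 1] by auto
  from this[of u] this[of v] this[of w] show ?thesis
    by (auto simp: z3_three_dvd_iff minus_z3.rep_eq)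
qed

section \<open>Return times and approximation by iterates near 1\<close>

lemma funpow_power: "((\<lambda>x. x ^ m) ^^ n) x = (x :: 'a::monoid_mult) ^ (m ^ n)"
  by (induction n arbitrary: x) (simp_all add: power_mult mult.commute flip: power_mult)

locale three_adic_power =
  fixes m t :: nat
  assumes t_pos: "t > 0"
    and dvd_Suc_m: "3 ^ t dvd m + 1"
    and not_dvd_Suc_m: "\<not> 3 ^ Suc t dvd m + 1"
begin

lemma three_dvd_Suc_m: "3 dvd m + 1"
  using t_pos dvd_Suc_m by (cases t) (auto intro: dvd_mult_left)

lemma m_ge_2: "m \<ge> 2"
  using three_dvd_Suc_m by presburger

lemma not_three_dvd_m: "\<not> 3 dvd m"
  using three_dvd_Suc_m by presburger

text \<open>In \<open>m ^ 2 - 1 = (m - 1) * (m + 1)\<close> the first factor is prime to 3, so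
  \<open>m ^ 2\<close> lies exactly at level \<open>t\<close>, and lifting the exponent applies to
  it over the integers.\<close>

lemma three_power_dvd_m_power_iff: "3 ^ (t + r) dvd m ^ (2 * j) - 1 \<longleftrightarrow> 3 ^ r dvd j"
proof -
  have fac: "(int m)\<^sup>2 - 1 = (int m - 1) * int (m + 1)"
    by (simp add: power2_eq_square algebra_simps)
  have cop: "coprime (3 ^ n) (int m - 1)" for n
  proof -
    have "\<not> 3 dvd int m - 1" using three_dvd_Suc_m by presburger
    then show ?thesis by (simp add: prime_imp_coprime)
  qed
  have d: "3 ^ n dvd (int m)\<^sup>2 - 1 \<longleftrightarrow> 3 ^ n dvd m + 1" for n
    unfolding fac using coprime_dvd_mult_right_iff[OF cop] int_dvd_int_iff[of "3 ^ n" "m + 1"]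
    by simp
  have "int (m ^ (2 * j) - 1) = ((int m)\<^sup>2) ^ j - 1"
    using m_ge_2 by (simp add: power_mult of_nat_diff)
  then have "3 ^ (t + r) dvd m ^ (2 * j) - 1 \<longleftrightarrow> 3 ^ (t + r) dvd ((int m)\<^sup>2) ^ j - 1"
    by (metis int_dvd_int_iff of_nat_numeral of_nat_power)
  also have "\<dots> \<longleftrightarrow> 3 ^ r dvd j"
    using t_pos dvd_Suc_m not_dvd_Suc_m
    by (intro three_power_dvd_power_minus_one_iff) (auto simp: d simp del: power_Suc)
  finally show ?thesis .
qed

text \<open>With \<open>N = m ^ (2 * j) - 1\<close> the difference is the unit \<open>x\<close>
  times \<open>x ^ N - 1\<close>. Lifting for \<open>x\<close> turns the claim into
  \<open>3 ^ (t + r) dvd N\<close>, and lifting for \<open>m ^ 2\<close> turns that into a condition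
  on \<open>j\<close>.\<close>

lemma z3_return_iff_principal:
  fixes x :: z3
  assumes "k > 0" "3 ^ k dvd x - 1" "\<not> 3 ^ Suc k dvd x - 1"
  shows "3 ^ (t + k + r) dvd x ^ (m ^ (2 * j)) - x \<longleftrightarrow> 3 ^ r dvd j"
proof -
  have "3 dvd x - 1" using assms(1,2) by (cases k) (auto intro: dvd_mult_left)
  then have nx: "\<not> 3 dvd x" by (rule z3_not_three_dvd_of_cong[rotated]) simp
  define N where "N = m ^ (2 * j) - 1"
  have "m ^ (2 * j) = Suc N" using m_ge_2 by (simp add: N_def)
  then have "x ^ (m ^ (2 * j)) - x = x * (x ^ N - 1)" by (simp add: algebra_simps)
  then have "3 ^ (t + k + r) dvd x ^ (m ^ (2 * j)) - x \<longleftrightarrow> 3 ^ (k + (t + r)) dvd x ^ N - 1"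
    by (simp only: z3_three_power_dvd_mult_iff[OF nx] ac_simps)
  also have "\<dots> \<longleftrightarrow> 3 ^ (t + r) dvd N"
    by (rule three_power_dvd_power_minus_one_iff[OF prime_elem_three_z3 assms])
  finally show ?thesis by (simp only: N_def three_power_dvd_m_power_iff)
qed

lemma z3_approx_principal:
  fixes x y :: z3
  assumes "k > 0" "3 ^ k dvd x - 1" "\<not> 3 ^ Suc k dvd x - 1" "3 ^ (t + k) dvd x - y"
  shows "\<exists>j. 3 ^ (t + k + r) dvd x ^ (m ^ (2 * j)) - y"
proof (induction r)
  case 0
  show ?case using assms(4) by (intro exI[of _ 0]) simp
next
  case (Suc r)
  then obtain j where j: "3 ^ (t + k + r) dvd x ^ (m ^ (2 * j)) - y" by blast
  \<comment> \<open>\<open>m ^ n\<close> is prime to 3, so all iterates keep the distance of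
    \<open>x\<close> from 1 and the return criterion applies to each of them.\<close>
  have exact: "3 ^ k dvd x ^ (m ^ n) - 1 \<and> \<not> 3 ^ Suc k dvd x ^ (m ^ n) - 1" for n
    using three_power_dvd_power_minus_one_iff[OF prime_elem_three_z3 assms(1-3), of 0 "m ^ n"]
      three_power_dvd_power_minus_one_iff[OF prime_elem_three_z3 assms(1-3), of 1 "m ^ n"]
      not_three_dvd_m by (auto simp: prime_dvd_power_nat_iff dest: prime_dvd_power_nat[rotated])
  \<comment> \<open>\<open>z i\<close> continues the approximating iterate by
    \<open>2 * 3 ^ r * i\<close> steps: few enough factors 3 to move at the next level, enough to
    stay put at the present one.\<close>
  define z where "z i = x ^ (m ^ (2 * (j + 3 ^ r * i)))" for i
  have z_add: "z (i + i') = z i ^ (m ^ (2 * (3 ^ r * i')))" for i i'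
    by (simp add: z_def algebra_simps power_add flip: power_mult)
  have near: "3 ^ (t + k + r) dvd z (i + i') - z i" for i i'
    using z3_return_iff_principal[OF assms(1), of "z i" r "3 ^ r * i'"] exact
    by (simp add: z_add) (simp add: z_def)
  have apart: "\<not> 3 ^ (t + k + Suc r) dvd z (i + i') - z i" if "\<not> 3 dvd i'" for i i'
    using z3_return_iff_principal[OF assms(1), of "z i" "Suc r" "3 ^ r * i'"] exact that
    by (simp add: z_add) (simp add: z_def)
  have "3 ^ (t + k + r) dvd z i - y" for i
  proof -
    have "3 ^ (t + k + r) dvd (z (0 + i) - z 0) + (z 0 - y)"
      by (intro dvd_add near) (simp add: z_def j)
    then show ?thesis by simp
  qed
  then have "\<exists>w. z i - y = 3 ^ (t + k + r) * w" for i by (auto elim: dvdE)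
  \<comment> \<open>\<open>w i\<close> is the next-level error of \<open>z i\<close>; the goal is an
    index at which 3 divides it.\<close>
  then obtain w where w: "\<And>i. z i - y = 3 ^ (t + k + r) * w i" by metis
  have step: "3 ^ (t + k + Suc r) dvd 3 ^ (t + k + r) * v \<longleftrightarrow> 3 dvd v" for v :: z3
    by (simp only: add_Suc_right power_Suc2 dvd_mult_cancel_left) simp
  have "\<not> 3 dvd w (i + i') - w i" if "\<not> 3 dvd i'" for i i'
  proof -
    have "z (i + i') - z i = 3 ^ (t + k + r) * (w (i + i') - w i)"
      using w[of i] w[of "i + i'"] by (simp add: algebra_simps)
    then show ?thesis using apart[OF that, of i] step by simp
  qed
  from this[of 1 0] this[of 2 0, simplified] this[of 1 1]
  have "\<not> 3 dvd w 1 - w 0" "\<not> 3 dvd w 2 - w 0" "\<not> 3 dvd w 2 - w 1"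
    by (simp_all add: numeral_2_eq_2)
  then have "3 dvd w 0 \<or> 3 dvd w 1 \<or> 3 dvd w 2"
    using z3_three_pigeonhole[of "w 0" "w 1" "w 2"] by blast
  then obtain i where "3 dvd w i" by blast
  then have "3 ^ (t + k + Suc r) dvd z i - y" by (simp only: w step)
  then show ?case unfolding z_def by blast
qed

end

section \<open>Balls, closures and attracting basins\<close>

lemma dvd_diff_swap: "d dvd a - b \<longleftrightarrow> d dvd b - (a :: 'a::comm_ring_1)"
  by (metis dvd_minus_iff minus_diff_eq)

lemma z3_dist_le_iff: "dist x y \<le> 1 / 3 ^ n \<longleftrightarrow> 3 ^ n dvd x - (y :: z3)"
  by (simp add: dist_z3_def z3_abs_le_iff)

lemma z3_coset_iff: "x \<in> z3_coset c n \<longleftrightarrow> 3 ^ n dvd x - c"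
  unfolding z3_coset_def by (auto simp: dvd_def algebra_simps)

lemma z3_coset_eq_cball: "z3_coset c n = cball c (1 / 3 ^ n)"
  by (auto simp: z3_coset_iff z3_dist_le_iff dvd_diff_swap[of _ _ c])

text \<open>Every point of a coset is a centre of it, so the same radius works around each
  point.\<close>

lemma open_z3_coset: "open (z3_coset c n)"
proof -
  have "cball x (1 / 3 ^ n) \<subseteq> z3_coset c n" if "x \<in> z3_coset c n" for x
    using that dvd_add[of "3 ^ n" "x - c"] unfolding z3_coset_eq_cball [symmetric]
    by (fastforce simp: z3_coset_iff)
  then show ?thesis
    unfolding open_contains_cball by (meson zero_less_divide_1_iff zero_less_numeral zero_less_power)
qed

lemma closed_z3_coset: "closed (z3_coset c n)"
  by (simp add: z3_coset_eq_cball)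

lemma z3_in_closureI:
  fixes y :: z3
  assumes "\<And>n. \<exists>x\<in>S. 3 ^ n dvd x - y"
  shows "y \<in> closure S"
  unfolding closure_approachable
proof (intro allI impI)
  fix e :: real
  assume "e > 0"
  then obtain n where n: "(1 / 3) ^ n < e" using real_arch_pow_inv[of e "1 / 3"] by auto
  obtain x where "x \<in> S" "3 ^ n dvd x - y" using assms by blast
  then have "dist x y \<le> 1 / 3 ^ n" by (simp add: z3_dist_le_iff)
  with n \<open>x \<in> S\<close> show "\<exists>x\<in>S. dist x y < e"
    by (intro bexI[of _ x]) (simp_all add: power_divide)
qed

text \<open>An orbit that enters an invariant set never leaves it, so the distances are eventually
  equal to 0.\<close>

lemma attracting_basinI:
  assumes "(f ^^ k) x \<in> A" "closed A" "f ` A \<subseteq> A"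
  shows "x \<in> attracting_basin f A"
proof -
  have "(f ^^ (n + k)) x \<in> A" for n
    using assms by (induction n) auto
  then have "eventually (\<lambda>n. infdist ((f ^^ n) x) A = 0) sequentially"
    unfolding eventually_sequentially by (metis infdist_zero le_add_diff_inverse2)
  then have "(\<lambda>n. infdist ((f ^^ n) x) A) \<longlonglongrightarrow> 0" by (rule tendsto_eventually)
  with assms show ?thesis unfolding attracting_basin_def by auto
qed

text \<open>Points incongruent modulo 3 are more than 1/3 apart, which bounds the distance to
  \<open>A\<close> from below along the whole orbit.\<close>

lemma z3_not_in_attracting_basin:
  fixes x :: z3
  assumes "\<And>n a. a \<in> A \<Longrightarrow> \<not> 3 dvd (f ^^ n) x - a"
  shows "x \<notin> attracting_basin f A"
proof
  assume x: "x \<in> attracting_basin f A"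
  then have ne: "A \<noteq> {}" by (simp add: attracting_basin_def)
  have "eventually (\<lambda>n. infdist ((f ^^ n) x) A < 1 / 3) sequentially"
    using x by (intro order_tendstoD(2)) (auto simp: attracting_basin_def)
  then obtain n where n: "infdist ((f ^^ n) x) A < 1 / 3"
    by (auto simp: eventually_sequentially)
  have "1 / 3 \<le> dist ((f ^^ n) x) a" if "a \<in> A" for a
    using assms[OF that, of n] z3_dist_le_iff[of "(f ^^ n) x" a 1] by auto
  then have "1 / 3 \<le> infdist ((f ^^ n) x) A"
    unfolding infdist_notempty[OF ne] using ne by (intro cINF_greatest)
  with n show False by simp
qed

section \<open>Congruence up to inversion and the components\<close>

lemma z3_unit_inverse_cong_iff:
  fixes x c :: z3
  assumes "\<not> 3 dvd c"
  shows "3 ^ n dvd x - unit_inverse c \<longleftrightarrow> 3 ^ n dvd x * c - 1"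
proof -
  have "x * c - 1 = c * (x - unit_inverse c)"
    using z3_unit_inverse[OF assms] by (simp add: algebra_simps)
  then show ?thesis by (simp add: z3_three_power_dvd_mult_iff[OF assms])
qed

text \<open>The leading term \<open>3 ^ k * w\<close>, known modulo the next power of 3, fixes the
  exact power of 3 in \<open>u\<close>.\<close>

lemma z3_exactI:
  fixes u w :: z3
  assumes "3 ^ Suc k dvd u - 3 ^ k * w" "\<not> 3 dvd w"
  shows "3 ^ k dvd u \<and> \<not> 3 ^ Suc k dvd u"
proof
  have "3 ^ k dvd (u - 3 ^ k * w) + 3 ^ k * w"
    using assms(1) by (intro dvd_add) (auto intro: dvd_mult_right)
  then show "3 ^ k dvd u" by simp
  show "\<not> 3 ^ Suc k dvd u"
  proof
    assume "3 ^ Suc k dvd u"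
    then have "3 ^ Suc k dvd u - (u - 3 ^ k * w)" using assms(1) by (rule dvd_diff)
    then have "3 ^ k * 3 dvd 3 ^ k * w" by (simp add: mult.commute)
    then show False using assms(2) by (simp only: dvd_mult_cancel_left) simp
  qed
qed

text \<open>On units, congruence up to inversion is an equivalence relation, and the components
  are classes of it.\<close>

definition z3_inv_cong :: "nat \<Rightarrow> z3 \<Rightarrow> z3 \<Rightarrow> bool" where
  "z3_inv_cong n x y \<longleftrightarrow> 3 ^ n dvd x - y \<or> 3 ^ n dvd x * y - 1"

lemma z3_inv_cong_sym: "z3_inv_cong n x y \<longleftrightarrow> z3_inv_cong n y x"
  unfolding z3_inv_cong_def by (simp add: dvd_diff_swap[of _ x] mult.commute)

text \<open>Two inversions compose to a congruence only after cancelling \<open>c\<close>, which is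
  where \<open>c\<close> must be a unit.\<close>

lemma z3_inv_cong_trans:
  assumes "z3_inv_cong n x c" "z3_inv_cong n c y" "\<not> 3 dvd c"
  shows "z3_inv_cong n x y"
proof -
  consider "3 ^ n dvd x - c" "3 ^ n dvd c - y" | "3 ^ n dvd x - c" "3 ^ n dvd c * y - 1"
    | "3 ^ n dvd x * c - 1" "3 ^ n dvd c - y" | "3 ^ n dvd x * c - 1" "3 ^ n dvd c * y - 1"
    using assms by (auto simp: z3_inv_cong_def)
  then show ?thesis
  proof cases
    case 1
    then have "3 ^ n dvd (x - c) + (c - y)" by (rule dvd_add)
    then show ?thesis by (simp add: z3_inv_cong_def)
  next
    case 2
    then have "3 ^ n dvd (x - c) * y + (c * y - 1)" by (intro dvd_add dvd_mult2)
    then show ?thesis by (simp add: z3_inv_cong_def algebra_simps)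
  next
    case 3
    then have "3 ^ n dvd (x * c - 1) - x * (c - y)" by (metis dvd_diff dvd_mult)
    then show ?thesis by (simp add: z3_inv_cong_def algebra_simps)
  next
    case 4
    then have "3 ^ n dvd (x * c - 1) - (c * y - 1)" by (rule dvd_diff)
    then have "3 ^ n dvd c * (x - y)" by (simp add: algebra_simps)
    then show ?thesis by (simp add: z3_inv_cong_def z3_three_power_dvd_mult_iff[OF assms(3)])
  qed
qed

definition M_center :: "z3 \<Rightarrow> nat \<Rightarrow> nat \<Rightarrow> z3" where
  "M_center e l a = e + 3 ^ (l + 1) + 3 ^ (l + 2) * of_nat a"

lemma M_center_minus: "M_center e l a - e = 3 ^ (l + 1) * (1 + 3 * of_nat a)"
  by (simp add: M_center_def algebra_simps)

lemma z3_not_three_dvd_M_center: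
  assumes "e * e = 1"
  shows "\<not> 3 dvd M_center e l a"
  by (rule z3_not_three_dvd_of_cong[OF z3_not_three_dvd_of_sq_eq_one[OF assms]])
    (simp add: M_center_minus)

text \<open>Multiplying by the centre, a unit, replaces \<open>unit_inverse\<close> by a congruence
  for a product.\<close>

lemma M_comp_iff:
  assumes "e * e = 1"
  shows "x \<in> M_comp e t l a \<longleftrightarrow> z3_inv_cong (t + l + 1) x (M_center e l a)"
  unfolding M_comp_def z3_inv_cong_def M_center_def [symmetric] Un_iff z3_coset_iff
  by (simp only: z3_unit_inverse_cong_iff[OF z3_not_three_dvd_M_center[OF assms]])

text \<open>As \<open>t > 0\<close>, the modulus is fine enough to see the leading term of the
  centre minus \<open>e\<close>, and inversion changes that term only by a unit. Thus
  \<open>l\<close> records the distance of the component from \<open>e\<close>.\<close>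

lemma M_comp_exact:
  assumes e: "e * e = 1" and "t > 0" and x: "x \<in> M_comp e t l a"
  shows "3 ^ (l + 1) dvd x - e \<and> \<not> 3 ^ Suc (l + 1) dvd x - e"
proof -
  define c where "c = M_center e l a"
  have c: "c - e = 3 ^ (l + 1) + 3 ^ Suc (l + 1) * of_nat a" by (simp add: c_def M_center_def)
  have nc: "\<not> 3 dvd c" unfolding c_def by (rule z3_not_three_dvd_M_center[OF e])
  have ne: "\<not> 3 dvd e" by (rule z3_not_three_dvd_of_sq_eq_one[OF e])
  have le: "(3 :: z3) ^ Suc (l + 1) dvd 3 ^ (t + l + 1)"
    using \<open>t > 0\<close> by (intro le_imp_power_dvd) simp
  consider "3 ^ (t + l + 1) dvd x - c" | "3 ^ (t + l + 1) dvd x * c - 1"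
    using x by (auto simp: M_comp_iff[OF e] z3_inv_cong_def c_def)
  then show ?thesis
  proof cases
    case 1
    then have "3 ^ Suc (l + 1) dvd (x - c) + 3 ^ Suc (l + 1) * of_nat a"
      by (intro dvd_add[OF dvd_trans[OF le]] dvd_triv_left)
    also have "(x - c) + 3 ^ Suc (l + 1) * of_nat a = (x - e) - 3 ^ (l + 1) * 1"
      using c by (simp add: algebra_simps)
    finally show ?thesis by (rule z3_exactI) simp
  next
    case 2
    \<comment> \<open>Replacing 1 by \<open>e * e\<close> in \<open>x * c - 1\<close> exhibits
      \<open>c * (x - e)\<close> with leading coefficient \<open>- e\<close>.\<close>
    then have "3 ^ Suc (l + 1) dvd (x * c - 1) - 3 ^ Suc (l + 1) * (e * of_nat a)"
      by (intro dvd_diff[OF dvd_trans[OF le]] dvd_triv_left)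
    also have "(x * c - 1) - 3 ^ Suc (l + 1) * (e * of_nat a) = c * (x - e) - 3 ^ (l + 1) * (- e)"
    proof -
      have "c = e + (3 ^ (l + 1) + 3 ^ Suc (l + 1) * of_nat a)" using c by (simp add: algebra_simps)
      then have "c * e = 1 + e * (3 ^ (l + 1) + 3 ^ Suc (l + 1) * of_nat a)"
        using e by (metis distrib_left mult.commute)
      then show ?thesis by (simp add: algebra_simps)
    qed
    finally have "3 ^ (l + 1) dvd c * (x - e) \<and> \<not> 3 ^ Suc (l + 1) dvd c * (x - e)"
      using ne by (intro z3_exactI[where w = "- e"]) simp_all
    then show ?thesis unfolding z3_three_power_dvd_mult_iff[OF nc] .
  qed
qed

section \<open>Dynamics near a fixed point \<open>e\<close>, which is 1 or -1\<close>

locale three_adic_power_sign = three_adic_power +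
  fixes e :: z3
  assumes sq: "e * e = 1" and fixed: "e ^ m = e"
begin

lemma power_iterate_sign: "e ^ (m ^ n) = e"
  by (induction n) (simp_all add: power_mult fixed)

lemma not_three_dvd_sign: "\<not> 3 dvd e"
  using sq by (rule z3_not_three_dvd_of_sq_eq_one)

lemma dvd_sign_mult_iff [simp]: "3 ^ n dvd e * x \<longleftrightarrow> 3 ^ n dvd x"
  by (rule z3_three_power_dvd_mult_iff[OF not_three_dvd_sign])

lemma sign_mult_minus_one: "e * x - 1 = e * (x - e)"
  using sq by (simp add: algebra_simps)

text \<open>Multiplication by \<open>e\<close> commutes with the iterates because they fix
  \<open>e\<close>; this transports the results near 1 to results near \<open>e\<close>.\<close>

lemma sign_mult_power_minus: "(e * x) ^ (m ^ n) - e * y = e * (x ^ (m ^ n) - y)"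
  by (simp add: power_mult_distrib power_iterate_sign algebra_simps)

context
  fixes k :: nat and x :: z3
  assumes k: "k > 0" and exact: "3 ^ k dvd x - e" "\<not> 3 ^ Suc k dvd x - e"
begin

lemma exact_sign_mult: "3 ^ k dvd e * x - 1" "\<not> 3 ^ Suc k dvd e * x - 1"
  using exact unfolding sign_mult_minus_one dvd_sign_mult_iff by blast+

lemma z3_return_iff: "3 ^ (t + k + r) dvd x ^ (m ^ (2 * j)) - x \<longleftrightarrow> 3 ^ r dvd j"
  using z3_return_iff_principal[OF k exact_sign_mult, of r j]
  unfolding sign_mult_power_minus dvd_sign_mult_iff .

lemma z3_approx:
  assumes "3 ^ (t + k) dvd x - y"
  shows "\<exists>j. 3 ^ (t + k + r) dvd x ^ (m ^ (2 * j)) - y"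
proof -
  have "3 ^ (t + k) dvd e * x - e * y"
    using assms by (simp flip: right_diff_distrib)
  from z3_approx_principal[OF k exact_sign_mult this, of r] show ?thesis
    unfolding sign_mult_power_minus dvd_sign_mult_iff .
qed

end

text \<open>Since \<open>e ^ (m + 1) = 1\<close>, the product is \<open>(e * x) ^ (m + 1)\<close>,
  and the factor \<open>3 ^ t\<close> of \<open>m + 1\<close> gains \<open>t\<close> powers of 3. So
  the map acts as inversion modulo \<open>3 ^ (t + k)\<close>.\<close>

lemma z3_power_near_inverse:
  assumes "k > 0" "3 ^ k dvd x - e"
  shows "3 ^ (t + k) dvd x ^ m * x - 1"
proof -
  obtain q where q: "m + 1 = 3 ^ t * q" using dvd_Suc_m by (elim dvdE)
  have "3 ^ k dvd e * x - 1" using assms by (simp add: sign_mult_minus_one)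
  then have "3 ^ (k + t) dvd (e * x) ^ (3 ^ t) - 1"
    using assms(1) by (rule three_power_dvd_of_power_dvd)
  also have "(e * x) ^ (3 ^ t) - 1 dvd ((e * x) ^ (3 ^ t)) ^ q - 1"
    using power_diff_sumr2[of "(e * x) ^ (3 ^ t)" q 1] by simp
  also have "((e * x) ^ (3 ^ t)) ^ q = (e * x) ^ (m + 1)"
    by (simp only: q power_mult)
  also have "\<dots> = x ^ m * x"
    by (simp add: power_mult_distrib fixed sq mult_ac flip: mult.assoc[of e e])
  finally show ?thesis by (simp add: add.commute)
qed

lemma z3_inv_cong_power:
  assumes "k > 0" "3 ^ k dvd x - e"
  shows "z3_inv_cong (t + k) (x ^ m) x"
  using z3_power_near_inverse[OF assms] by (simp add: z3_inv_cong_def)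

lemma M_comp_unit:
  assumes "x \<in> M_comp e t l a"
  shows "\<not> 3 dvd x"
proof -
  have "3 dvd x - e" using M_comp_exact[OF sq t_pos assms] by (auto dest: dvd_mult_left)
  then show ?thesis by (rule z3_not_three_dvd_of_cong[OF not_three_dvd_sign])
qed

lemma M_comp_power:
  assumes "x \<in> M_comp e t l a"
  shows "x ^ m \<in> M_comp e t l a"
proof -
  have "z3_inv_cong (t + (l + 1)) (x ^ m) x"
    using M_comp_exact[OF sq t_pos assms] by (intro z3_inv_cong_power) auto
  from z3_inv_cong_trans[OF this _ M_comp_unit[OF assms]] assms show ?thesis
    unfolding M_comp_iff[OF sq] add.assoc by blast
qed

lemma M_comp_orbit_dense:
  assumes x: "x \<in> M_comp e t l a" and y: "y \<in> M_comp e t l a"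
  shows "\<exists>n. 3 ^ r dvd x ^ (m ^ n) - y"
proof -
  have nx: "\<not> 3 dvd x" using x by (rule M_comp_unit)
  have approx: "\<exists>j. 3 ^ r dvd z ^ (m ^ (2 * j)) - y"
    if z: "z \<in> M_comp e t l a" and zy: "3 ^ (t + (l + 1)) dvd z - y" for z
  proof -
    have "l + 1 > 0" by simp
    from z3_approx[OF this _ _ zy, of r] M_comp_exact[OF sq t_pos z]
    obtain j where "3 ^ (t + (l + 1) + r) dvd z ^ (m ^ (2 * j)) - y" by (elim conjE) fast
    moreover have "(3 :: z3) ^ r dvd 3 ^ (t + (l + 1) + r)" by (intro le_imp_power_dvd) simp
    ultimately show ?thesis by (blast intro: dvd_trans)
  qed
  have "z3_inv_cong (t + (l + 1)) x y"
    using x y z3_inv_cong_sym z3_not_three_dvd_M_center[OF sq]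
    unfolding M_comp_iff[OF sq] add.assoc by (blast intro: z3_inv_cong_trans)
  then consider "3 ^ (t + (l + 1)) dvd x - y" | "3 ^ (t + (l + 1)) dvd x * y - 1"
    by (auto simp: z3_inv_cong_def)
  then show ?thesis
  proof cases
    case 1
    then show ?thesis using approx[OF x] by blast
  next
    case 2
    \<comment> \<open>Here \<open>y\<close> is close to the inverse of \<open>x\<close>, and so is
      \<open>x ^ m\<close>; one application of the map reduces to the congruent case.\<close>
    have "3 ^ (t + (l + 1)) dvd x ^ m * x - 1"
      using M_comp_exact[OF sq t_pos x] by (intro z3_power_near_inverse) auto
    then have "3 ^ (t + (l + 1)) dvd (x ^ m * x - 1) - (x * y - 1)"
      using 2 by (rule dvd_diff)
    also have "(x ^ m * x - 1) - (x * y - 1) = x * (x ^ m - y)" by (simp add: algebra_simps)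
    finally have "3 ^ (t + (l + 1)) dvd x ^ m - y"
      unfolding z3_three_power_dvd_mult_iff[OF nx] .
    then obtain j where "3 ^ r dvd (x ^ m) ^ (m ^ (2 * j)) - y"
      using approx[OF M_comp_power[OF x]] by blast
    then have "3 ^ r dvd x ^ (m ^ Suc (2 * j)) - y" by (simp add: power_mult)
    then show ?thesis by blast
  qed
qed

lemma minimal_component_M_comp: "minimal_component (\<lambda>x. x ^ m) (M_comp e t l a)"
  unfolding minimal_component_def
proof (intro conjI ballI subsetI)
  have "M_center e l a \<in> M_comp e t l a" by (simp add: M_comp_iff[OF sq] z3_inv_cong_def)
  then show "M_comp e t l a \<noteq> {}" by blast
  show "open (M_comp e t l a)" "closed (M_comp e t l a)"
    unfolding M_comp_def by (simp_all add: open_Un closed_Un open_z3_coset closed_z3_coset)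
  show "finite_union_of_balls (M_comp e t l a)"
  proof -
    have "\<exists>c r. r > 0 \<and> z3_coset u n = cball c r" for u n
      by (rule exI[of _ u], rule exI[of _ "1 / 3 ^ n"]) (simp add: z3_coset_eq_cball)
    then show ?thesis
      unfolding finite_union_of_balls_def M_comp_def
      by (intro exI[of _ "{z3_coset u n, z3_coset v n}" for u v n]) auto
  qed
next
  fix x assume "x \<in> (\<lambda>x. x ^ m) ` M_comp e t l a"
  then show "x \<in> M_comp e t l a" using M_comp_power by blast
next
  fix x y assume "x \<in> M_comp e t l a" "y \<in> M_comp e t l a"
  then show "y \<in> closure (forward_orbit (\<lambda>x. x ^ m) x)"
    using M_comp_orbit_dense[of x l a y]
    by (intro z3_in_closureI) (simp add: forward_orbit_def funpow_power Bex_def, metis)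
qed

text \<open>A periodic point returns exactly, hence modulo every power of 3. At finite distance
  level \<open>k\<close> from \<open>e\<close>, the return criterion would make the period divisible
  by arbitrarily high powers of 3.\<close>

lemma periodic_eq_sign:
  assumes "x \<in> periodic_points (\<lambda>x. x ^ m)" "3 dvd x - e"
  shows "x = e"
proof (rule ccontr)
  assume "x \<noteq> e"
  then have val: "3 ^ n dvd x - e \<longleftrightarrow> n \<le> z3_val (x - e)" for n
    by (simp add: three_power_dvd_iff_val)
  define k where "k = z3_val (x - e)"
  have k: "k > 0" "3 ^ k dvd x - e" "\<not> 3 ^ Suc k dvd x - e"
    using val[of 1] assms(2) by (simp_all add: val k_def del: power_Suc)
  obtain n where n: "n > 0" "x ^ (m ^ n) = x"
    using assms(1) by (auto simp: periodic_points_def funpow_power)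
  have "x ^ (m ^ (2 * n)) = (x ^ (m ^ n)) ^ (m ^ n)"
    by (simp add: mult_2 power_add flip: power_mult)
  with n have "x ^ (m ^ (2 * n)) - x = 0" by simp
  \<comment> \<open>The period is doubled to fit the even iterates of the criterion;
    \<open>r = n\<close> already exceeds what \<open>n\<close> can be divisible by.\<close>
  then have "3 ^ n dvd n" using z3_return_iff[OF k, of n n] by simp
  then have "3 ^ n \<le> n" using n by (simp add: dvd_imp_le)
  moreover have "n < 3 ^ n" by (rule less_exp [THEN less_le_trans]) (simp add: power_mono)
  ultimately show False by simp
qed

text \<open>The leading coefficient \<open>u\<close> of \<open>x - e\<close> is 1 or 2 modulo 3. If
  it is 1, \<open>x\<close> lies in the ball around a centre; if it is 2, inversion changes it to
  1.\<close>

lemma M_comp_cover: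
  assumes "3 dvd x - e" "x \<noteq> e"
  shows "\<exists>l a. a \<le> 3 ^ (t - 1) - 1 \<and> x \<in> M_comp e t l a"
proof -
  have val: "3 ^ n dvd x - e \<longleftrightarrow> n \<le> z3_val (x - e)" for n
    using assms by (simp add: three_power_dvd_iff_val)
  obtain l where l: "z3_val (x - e) = Suc l"
    using val[of 1] assms(1) by (cases "z3_val (x - e)") auto
  obtain u where u: "x - e = 3 ^ Suc l * u" "\<not> 3 dvd u"
    using z3_factor[of "x - e"] assms(2) l by auto
  have near: "\<exists>a. a \<le> 3 ^ (t - 1) - 1 \<and> 3 ^ (t + l + 1) dvd y - M_center e l a"
    if y: "y - e = 3 ^ Suc l * v" "3 dvd v - 1" for y v
  proof -
    obtain w where w: "v = 1 + 3 * w" using y(2) by (metis add.commute diff_add_cancel dvdE)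
    \<comment> \<open>The first \<open>t - 1\<close> digits of \<open>w\<close> suffice, since
      \<open>w\<close> is multiplied by \<open>3 ^ (l + 2)\<close> and the modulus is
      \<open>3 ^ (t + l + 1)\<close>.\<close>
    define a where "a = nat (res w (t - 1))"
    have a: "int a = res w (t - 1)" by (simp add: a_def res_bounds)
    have "int a < 3 ^ (t - 1)" by (simp add: a res_bounds)
    then have "a < 3 ^ (t - 1)" by (metis of_nat_less_iff of_nat_numeral of_nat_power)
    moreover have "3 ^ (t - 1) dvd w - of_nat a"
      by (simp add: three_power_dvd_iff minus_z3.rep_eq res_of_nat a)
    then have "3 ^ (l + 2) * 3 ^ (t - 1) dvd 3 ^ (l + 2) * (w - of_nat a)"
      by (rule mult_dvd_mono[OF dvd_refl])
    moreover have "3 ^ (l + 2) * (w - of_nat a) = y - M_center e l a"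
    proof -
      have "y = e + 3 ^ Suc l * (1 + 3 * w)" using y(1) w by (simp add: algebra_simps)
      then show ?thesis by (simp add: M_center_def algebra_simps)
    qed
    moreover have "(3 :: z3) ^ (l + 2) * 3 ^ (t - 1) = 3 ^ (t + l + 1)"
    proof -
      have "(l + 2) + (t - 1) = t + l + 1" using t_pos by simp
      then show ?thesis by (metis power_add)
    qed
    ultimately have "a \<le> 3 ^ (t - 1) - 1 \<and> 3 ^ (t + l + 1) dvd y - M_center e l a"
      by (metis Suc_pred' less_Suc_eq_le zero_less_numeral zero_less_power)
    then show ?thesis by blast
  qed
  consider "3 dvd u - 1" | "3 dvd u - 2"
    using u(2) z3_mod_three_cases[of u] by blast
  then show ?thesis
  proof cases
    case 1
    from near[OF u(1) this] show ?thesis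
      unfolding M_comp_iff[OF sq] z3_inv_cong_def by blast
  next
    case 2
    have nx: "\<not> 3 dvd x" using z3_not_three_dvd_of_cong[OF not_three_dvd_sign assms(1)] .
    define y where "y = unit_inverse x"
    have xy: "x * y = 1" unfolding y_def by (rule z3_unit_inverse[OF nx])
    define v where "v = - (y * e * u)"
    have "y - e = - (y * e * (x - e))"
    proof -
      have "y * e * (x - e) = (x * y) * e - y * (e * e)" by (simp add: algebra_simps)
      then show ?thesis by (simp add: xy sq)
    qed
    then have "y - e = 3 ^ Suc l * v" by (simp add: v_def u(1) algebra_simps)
    moreover have "3 dvd v - 1"
    proof -
      \<comment> \<open>Multiplying by the unit \<open>x * e\<close> clears the inverse
        \<open>y\<close> and leaves only visible multiples of 3.\<close>
      have "x * e * (v - 1) = - (x * y) * (e * e) * u - x * e"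
        by (simp add: v_def algebra_simps)
      also have "\<dots> = - (u - 2) - e * (x - e) - 3"
        by (simp add: xy sq algebra_simps)
      finally have "3 dvd x * e * (v - 1)"
        using 2 assms(1) by (auto intro!: dvd_diff dvd_mult simp: dvd_minus_iff simp del: minus_diff_eq)
      then show ?thesis using nx not_three_dvd_sign by (simp add: z3_three_dvd_mult_iff)
    qed
    ultimately obtain a where a: "a \<le> 3 ^ (t - 1) - 1" "3 ^ (t + l + 1) dvd y - M_center e l a"
      using near by blast
    have "x * M_center e l a - 1 = - (x * (y - M_center e l a))"
      by (simp add: right_diff_distrib xy)
    with a(2) have "3 ^ (t + l + 1) dvd x * M_center e l a - 1"
      by (simp only: dvd_minus_iff dvd_mult)
    with a(1) show ?thesis unfolding M_comp_iff[OF sq] z3_inv_cong_def by blast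
  qed
qed

text \<open>The distance to \<open>e\<close> determines \<open>l\<close>. Two centres at the same
  level are never mutually inverse at this modulus, so they are congruent, and the index range
  forces equality.\<close>

lemma M_comp_disjoint:
  assumes x: "x \<in> M_comp e t l a" "x \<in> M_comp e t l' b"
    and ab: "a \<le> 3 ^ (t - 1) - 1" "b \<le> 3 ^ (t - 1) - 1"
  shows "l = l' \<and> a = b"
proof
  have "l \<le> l'" if "3 ^ (l + 1) dvd x - e" "\<not> 3 ^ Suc (l' + 1) dvd x - e" for l l'
  proof (rule ccontr)
    assume "\<not> l \<le> l'"
    then have "(3 :: z3) ^ Suc (l' + 1) dvd 3 ^ (l + 1)" by (intro le_imp_power_dvd) simp
    with that show False by (blast intro: dvd_trans)
  qed
  with M_comp_exact[OF sq t_pos x(1)] M_comp_exact[OF sq t_pos x(2)]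
  show "l = l'" by (meson le_antisym)
  have "z3_inv_cong (t + l + 1) (M_center e l a) x" "z3_inv_cong (t + l + 1) x (M_center e l b)"
    using x z3_inv_cong_sym unfolding M_comp_iff[OF sq] \<open>l = l'\<close> by blast+
  then have "z3_inv_cong (t + l + 1) (M_center e l a) (M_center e l b)"
    using M_comp_unit[OF x(1)] by (rule z3_inv_cong_trans)
  moreover have "\<not> 3 ^ (t + l + 1) dvd M_center e l a * M_center e l b - 1"
  proof
    define A B :: z3 where "A = of_nat a" and "B = of_nat b"
    assume d: "3 ^ (t + l + 1) dvd M_center e l a * M_center e l b - 1"
    have "(3 :: z3) ^ (l + 1) * 3 dvd 3 ^ (t + l + 1)"
      unfolding power_Suc2 [symmetric] using t_pos by (intro le_imp_power_dvd) simp
    then have "3 ^ (l + 1) * 3 dvd M_center e l a * M_center e l b - 1"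
      using d by (rule dvd_trans)
    \<comment> \<open>The coefficient of \<open>3 ^ (l + 1)\<close> is \<open>2 * e\<close> modulo
      3, a unit.\<close>
    also have "M_center e l a * M_center e l b - 1
        = e * e - 1 + 3 ^ (l + 1) * (e * 2 + 3 * (e * (A + B) + 3 ^ l * (1 + 3 * A) * (1 + 3 * B)))"
      by (simp add: M_center_def algebra_simps flip: A_def B_def)
    also have "e * e - 1 = 0" by (simp add: sq)
    finally have "3 ^ (l + 1) * 3
        dvd 3 ^ (l + 1) * (e * 2 + 3 * (e * (A + B) + 3 ^ l * (1 + 3 * A) * (1 + 3 * B)))"
      by (simp only: add_0)
    then have "3 dvd e * 2 + 3 * (e * (A + B) + 3 ^ l * (1 + 3 * A) * (1 + 3 * B))"
      unfolding dvd_mult_cancel_left by simp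
    then have "3 dvd e * 2" by (simp only: dvd_add_left_iff dvd_triv_left)
    then show False using not_three_dvd_sign three_dvd_of_nat_iff[OF prime_elem_three_z3, of 2]
      by (simp add: z3_three_dvd_mult_iff)
  qed
  ultimately have "3 ^ (t + l + 1) dvd M_center e l a - M_center e l b"
    by (auto simp: z3_inv_cong_def)
  also have "M_center e l a - M_center e l b = 3 ^ (l + 2) * (of_nat a - of_nat b)"
    by (simp add: M_center_def algebra_simps)
  \<comment> \<open>Removing \<open>3 ^ (l + 2)\<close> leaves a congruence modulo
    \<open>3 ^ (t - 1)\<close>, the number of admissible indices.\<close>
  also have "t + l + 1 = (l + 2) + (t - 1)" using t_pos by simp
  finally have "3 ^ (t - 1) dvd (of_nat a - of_nat b :: z3)"
    by (metis dvd_mult_cancel_left power_add power_not_zero z3_three_neq_0)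
  then have "int a mod 3 ^ (t - 1) = int b mod 3 ^ (t - 1)"
    by (simp add: three_power_dvd_iff minus_z3.rep_eq res_of_nat mod_simps mod_eq_dvd_iff mod_eq_0_iff_dvd)
  moreover have "int c mod 3 ^ (t - 1) = int c" if "c \<le> 3 ^ (t - 1) - 1" for c
  proof -
    have "c < 3 ^ (t - 1)" using that by (metis Suc_pred' le_imp_less_Suc zero_less_numeral zero_less_power)
    then have "int c < 3 ^ (t - 1)" by (metis of_nat_less_iff of_nat_numeral of_nat_power)
    then show ?thesis by simp
  qed
  ultimately show "a = b" using ab by simp
qed

end

section \<open>Periodic points and basins by residue class modulo 3\<close>

lemma M_comp_cong_sign: "e * e = 1 \<Longrightarrow> t > 0 \<Longrightarrow> x \<in> M_comp e t l a \<Longrightarrow> 3 dvd x - e"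
  by (drule (2) M_comp_exact) (auto dest: dvd_mult_left)

text \<open>For nonzero \<open>x\<close>, cancelling in \<open>x ^ (m ^ n) = x\<close> with exponent
  at least 2 would make \<open>x\<close> a unit.\<close>

lemma z3_periodic_eq_0:
  assumes "m \<ge> 2" "x \<in> periodic_points (\<lambda>x. x ^ m)" "3 dvd x"
  shows "x = (0 :: z3)"
proof (rule ccontr)
  assume x: "x \<noteq> 0"
  obtain n where n: "n > 0" "x ^ (m ^ n) = x"
    using assms(2) by (auto simp: periodic_points_def funpow_power)
  have "m ^ 1 \<le> m ^ n" using n assms(1) by (intro power_increasing) auto
  then obtain q where q: "m ^ n = Suc (Suc q)"
    using assms(1) by (metis Suc_le_D add_2_eq_Suc le_trans numeral_2_eq_2 power_one_right Suc_le_mono)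
  have "x * (x * x ^ q) = x * 1" using n(2) by (simp add: q)
  then have "x * x ^ q = 1" using x by (simp only: mult_cancel_left) simp
  then show False using assms(3) by (metis dvd_mult2 z3_not_three_dvd_one)
qed

lemma fixed_point_periodic: "f x = x \<Longrightarrow> x \<in> periodic_points f"
  unfolding periodic_points_def by (auto intro!: exI[of _ 1])

lemma forward_orbit_fixed: "f x = x \<Longrightarrow> forward_orbit f x = {x}"
proof -
  assume "f x = x"
  then have "(f ^^ n) x = x" for n by (induction n) auto
  then show ?thesis by (auto simp: forward_orbit_def)
qed

text \<open>Iterates of a multiple of 3 are divisible by \<open>3 ^ n\<close> because
  \<open>m ^ n\<close> is at least \<open>n\<close>; iterates of a unit remain units, away from
  0.\<close>

lemma z3_attracting_basin_0:
  assumes "m \<ge> 2"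
  shows "attracting_basin (\<lambda>x. x ^ m) {0} = z3_coset 0 1"
proof (intro equalityI subsetI)
  fix x assume x: "x \<in> attracting_basin (\<lambda>x. x ^ m) {0 :: z3}"
  show "x \<in> z3_coset 0 1"
  proof (rule ccontr)
    assume "x \<notin> z3_coset 0 1"
    then have "\<not> 3 dvd x" by (simp add: z3_coset_iff)
    then have "x \<notin> attracting_basin (\<lambda>x. x ^ m) {0 :: z3}"
      by (intro z3_not_in_attracting_basin) (auto simp: funpow_power dest: z3_not_three_dvd_power)
    with x show False by blast
  qed
next
  fix x assume "x \<in> z3_coset 0 1"
  then have x: "3 dvd x" by (simp add: z3_coset_iff)
  have "dist (x ^ (m ^ n)) 0 \<le> (1 / 3) ^ n" for n
  proof -
    have "n \<le> m ^ n" using assms less_exp[of n] power_mono[of 2 m n] by simp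
    then have "(3 :: z3) ^ n dvd 3 ^ (m ^ n)" by (rule le_imp_power_dvd)
    also have "\<dots> dvd x ^ (m ^ n)" using x by (rule dvd_power_same)
    finally show ?thesis
      using z3_dist_le_iff[of "x ^ (m ^ n)" 0 n] by (simp add: power_divide)
  qed
  then have "(\<lambda>n. dist (x ^ (m ^ n)) 0) \<longlonglongrightarrow> 0"
    by (intro tendsto_sandwich[OF _ _ tendsto_const LIMSEQ_power_zero[of "1 / 3 :: real"]]) auto
  then show "x \<in> attracting_basin (\<lambda>x. x ^ m) {0}"
    using assms by (simp add: attracting_basin_def funpow_power)
qed

text \<open>Squares of units are 1 modulo 3, so an even power sends every unit into the coset in one
  step; multiples of 3 never get near it.\<close>

lemma z3_attracting_basin_one_coset:
  assumes "even m" "m \<ge> 2"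
  shows "attracting_basin (\<lambda>x. x ^ m) (z3_coset 1 1) = z3_coset 1 1 \<union> z3_coset 2 1"
proof (intro equalityI subsetI)
  fix x assume x: "x \<in> attracting_basin (\<lambda>x. x ^ m) (z3_coset 1 1)"
  have "\<not> 3 dvd x"
  proof
    assume "3 dvd x"
    then have "3 dvd x ^ (m ^ n)" for n using assms by (simp add: dvd_power_le[of 3 x 1, simplified])
    then have "x \<notin> attracting_basin (\<lambda>x. x ^ m) (z3_coset 1 1)"
      by (intro z3_not_in_attracting_basin)
        (metis funpow_power power_one_right z3_coset_iff z3_not_three_dvd_of_cong z3_not_three_dvd_one)
    with x show False by blast
  qed
  then show "x \<in> z3_coset 1 1 \<union> z3_coset 2 1"
    using z3_mod_three_cases[of x] by (auto simp: z3_coset_iff)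
next
  have one: "x ^ n \<in> z3_coset 1 1" if "x \<in> z3_coset 1 1" for x n
    using that power_diff_sumr2[of x n 1] by (simp add: z3_coset_iff)
  fix x assume x: "x \<in> z3_coset 1 1 \<union> z3_coset 2 1"
  have "x ^ 2 \<in> z3_coset 1 1"
  proof -
    have "3 dvd x - 1 \<or> 3 dvd x + 1"
    proof (cases "x \<in> z3_coset 1 1")
      case False
      then have "3 dvd (x - 2) + 3" using x by (intro dvd_add) (auto simp: z3_coset_iff)
      then show ?thesis by (simp add: add.commute)
    qed (simp add: z3_coset_iff)
    then have "3 dvd (x - 1) * (x + 1)" by auto
    then show ?thesis by (simp add: z3_coset_iff power2_eq_square algebra_simps)
  qed
  then have "x ^ m \<in> z3_coset 1 1"
    using one[of "x ^ 2" "m div 2"] assms(1) by (simp flip: power_mult)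
  then show "x \<in> attracting_basin (\<lambda>x. x ^ m) (z3_coset 1 1)"
    by (intro attracting_basinI[of 1])
      (auto simp: closed_z3_coset funpow_power simp del: One_nat_def intro: one)
qed

lemma z3_three_cosets: "z3_coset 0 1 \<union> z3_coset 1 1 \<union> z3_coset 2 1 = UNIV"
proof -
  have "x \<in> z3_coset 0 1 \<union> z3_coset 1 1 \<union> z3_coset 2 1" for x
    by (cases rule: z3_mod_three_cases[of x]) (simp_all add: z3_coset_iff)
  then show ?thesis by blast
qed

lemma z3_cosets_disjoint:
  "z3_coset 0 1 \<inter> z3_coset 1 1 = {}" "z3_coset 0 1 \<inter> z3_coset 2 1 = {}"
  "z3_coset 1 1 \<inter> z3_coset 2 1 = {}"
proof -
  have "z3_coset c n \<inter> z3_coset d n = {}" if "\<not> 3 ^ n dvd d - c" for c d n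
    using that dvd_diff[of "3 ^ n" "x - c" "x - d" for x] by (auto simp: z3_coset_iff)
  moreover have "\<not> (3 :: z3) dvd 2"
    using three_dvd_of_nat_iff[OF prime_elem_three_z3, of 2] by simp
  ultimately show "z3_coset 0 1 \<inter> z3_coset 1 1 = {}" "z3_coset 0 1 \<inter> z3_coset 2 1 = {}"
    "z3_coset 1 1 \<inter> z3_coset 2 1 = {}"
    by simp_all
qed

lemma z3_coset_minus_one: "z3_coset (- 1) 1 = z3_coset 2 1"
proof -
  have "3 dvd x - (- 1) \<longleftrightarrow> 3 dvd x - 2" for x :: z3
    using dvd_add_left_iff[of 3 3 "x - 2"] by (simp add: add.commute)
  then show ?thesis by (auto simp: z3_coset_iff)
qed

lemma (in three_adic_power_sign) UN_M_comp:
  "(\<Union>(l, a)\<in>UNIV \<times> {0..3 ^ (t - 1) - 1}. M_comp e t l a) = z3_coset e 1 - {e}"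
proof (intro equalityI subsetI)
  fix x assume "x \<in> (\<Union>(l, a)\<in>UNIV \<times> {0..3 ^ (t - 1) - 1}. M_comp e t l a)"
  then obtain l a where x: "x \<in> M_comp e t l a" by auto
  \<comment> \<open>For \<open>x = e\<close> the difference 0 would be divisible by every power of
    3.\<close>
  have "x \<noteq> e" using M_comp_exact[OF sq t_pos x] by auto
  then show "x \<in> z3_coset e 1 - {e}"
    using M_comp_cong_sign[OF sq t_pos x] by (simp add: z3_coset_iff)
next
  fix x assume "x \<in> z3_coset e 1 - {e}"
  then show "x \<in> (\<Union>(l, a)\<in>UNIV \<times> {0..3 ^ (t - 1) - 1}. M_comp e t l a)"
    using M_comp_cover[of x] by (fastforce simp: z3_coset_iff)
qed

lemma (in three_adic_power_sign) disjoint_family_M_comp: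
  "disjoint_family_on (\<lambda>(l, a). M_comp e t l a) (UNIV \<times> {0..3 ^ (t - 1) - 1})"
  unfolding disjoint_family_on_def
proof (intro ballI impI)
  fix p q :: "nat \<times> nat"
  assume "p \<in> UNIV \<times> {0..3 ^ (t - 1) - 1}" "q \<in> UNIV \<times> {0..3 ^ (t - 1) - 1}" "p \<noteq> q"
  moreover obtain l a l' b where pq: "p = (l, a)" "q = (l', b)" by (cases p, cases q)
  ultimately have "a \<le> 3 ^ (t - 1) - 1" "b \<le> 3 ^ (t - 1) - 1" "\<not> (l = l' \<and> a = b)" by auto
  then have "M_comp e t l a \<inter> M_comp e t l' b = {}" using M_comp_disjoint by blast
  then show "(case p of (l, a) \<Rightarrow> M_comp e t l a) \<inter> (case q of (l, a) \<Rightarrow> M_comp e t l a) = {}"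
    by (simp add: pq)
qed

section \<open>Assembly of the decomposition for even and odd exponents\<close>

theorem theorem4p5:
  fixes m t :: nat and f :: "z3 \<Rightarrow> z3"
  assumes "m \<ge> 2" and "[m = 2] (mod 3)"
    and "f = (\<lambda>x. x ^ m)"
    and "t = multiplicity 3 (m + 1)"
  shows
    "([m = 2] (mod 6) \<longrightarrow>
        minimal_decomposition f
          {0, 1}
          (UNIV \<times> {0..3 ^ (t - 1) - 1}) (\<lambda>(l, a). M_comp 1 t l a)
          ((z3_coset 0 1 - {0}) \<union> z3_coset 2 1) \<and>
        (\<forall>x\<in>{0, 1}. f x = x) \<and>
        z3_coset 0 1 - {0} = attracting_basin f {0} - {0} \<and>
        z3_coset 2 1 = attracting_basin f (z3_coset 1 1) - z3_coset 1 1) \<and>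
     ([m = 5] (mod 6) \<longrightarrow>
        minimal_decomposition f
          {0, 1, -1}
          (UNIV \<times> {0..3 ^ (t - 1) - 1} \<times> {1, 2})
          (\<lambda>(l, a, i). if i = (1::nat) then M_comp 1 t l a else M_comp (-1) t l a)
          (z3_coset 0 1 - {0}) \<and>
        (\<forall>x\<in>{0, 1, -1}. f x = x) \<and>
        z3_coset 0 1 - {0} = attracting_basin f {0} - {0})"
proof -
  have m: "3 dvd m + 1"
    using assms(2) unfolding cong_def by presburger
  have t: "3 ^ n dvd m + 1 \<longleftrightarrow> n \<le> t" for n
    unfolding assms(4) by (rule power_dvd_iff_le_multiplicity) auto
  \<comment> \<open>\<open>t > 0\<close> follows from \<open>3 dvd m + 1\<close>, so
    \<open>t - 1\<close> in the index range is a true subtraction.\<close>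
  interpret three_adic_power m t
    by standard (use t[of 1] t m in \<open>auto simp del: power_Suc\<close>)
  interpret pos: three_adic_power_sign m t 1
    by standard auto
  have m0: "m > 0" using assms(1) by simp
  let ?A = "{0..3 ^ (t - 1) - 1} :: nat set"
  have zero: "0 \<in> z3_coset 0 1" and one: "1 \<in> z3_coset 1 1" and minus_one: "- 1 \<in> z3_coset 2 1"
    by (simp_all add: z3_coset_iff flip: z3_coset_minus_one)
  note cosets = z3_three_cosets z3_cosets_disjoint zero one minus_one
  have basin0: "attracting_basin f {0} = z3_coset 0 1"
    unfolding assms(3) by (rule z3_attracting_basin_0[OF assms(1)])
  have orbit0: "forward_orbit f 0 = {0}" and orbit1: "forward_orbit f 1 = {1}"
    by (rule forward_orbit_fixed; use m0 assms(3) in simp)+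
  have periodic01: "0 \<in> periodic_points f" "1 \<in> periodic_points f"
    by (rule fixed_point_periodic; use m0 assms(3) in simp)+
  have per0: "x = 0" if "x \<in> periodic_points f" "x \<in> z3_coset 0 1" for x
    using z3_periodic_eq_0[OF assms(1)] that by (simp add: assms(3) z3_coset_iff)
  have per1: "x = 1" if "x \<in> periodic_points f" "x \<in> z3_coset 1 1" for x
    using pos.periodic_eq_sign that by (simp add: assms(3) z3_coset_iff)
  have even_case: "minimal_decomposition f {0, 1} (UNIV \<times> ?A) (\<lambda>(l, a). M_comp 1 t l a)
      ((z3_coset 0 1 - {0}) \<union> z3_coset 2 1) \<and>
      z3_coset 2 1 = attracting_basin f (z3_coset 1 1) - z3_coset 1 1" if "even m"
  proof
    have basin1: "attracting_basin f (z3_coset 1 1) = z3_coset 1 1 \<union> z3_coset 2 1"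
      unfolding assms(3) by (rule z3_attracting_basin_one_coset[OF that assms(1)])
    then show "z3_coset 2 1 = attracting_basin f (z3_coset 1 1) - z3_coset 1 1"
      using cosets by blast
    have f_coset1: "f x \<in> z3_coset 1 1" if "x \<in> z3_coset 1 1" for x
      using that power_diff_sumr2[of x m 1] by (simp add: z3_coset_iff assms(3))
    have f_coset2: "f x \<in> z3_coset 1 1" if "x \<in> z3_coset 2 1" for x
    proof -
      \<comment> \<open>An even power takes the same value at \<open>x\<close> and
        \<open>- x\<close>, which reduces the class of 2 to that of 1.\<close>
      have "- x \<in> z3_coset 1 1"
        using that unfolding z3_coset_minus_one [symmetric]
        by (simp add: z3_coset_iff) (metis dvd_minus_iff minus_add_distrib uminus_add_conv_diff add.commute minus_diff_eq)
      from f_coset1[OF this] show ?thesis using \<open>even m\<close> by (simp add: assms(3))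
    qed
    have per2: "x \<notin> z3_coset 2 1" if per: "x \<in> periodic_points f" for x
    proof
      assume "x \<in> z3_coset 2 1"
      \<comment> \<open>All positive iterates lie in the class of 1, so no orbit returns to the
        class of 2.\<close>
      then have *: "(f ^^ Suc n) x \<in> z3_coset 1 1" for n
        by (induction n) (simp_all add: f_coset1 f_coset2 del: One_nat_def)
      obtain n where "n > 0" "(f ^^ n) x = x" using per by (auto simp: periodic_points_def)
      with *[of "n - 1"] have "x \<in> z3_coset 1 1" by simp
      with \<open>x \<in> z3_coset 2 1\<close> show False using cosets by blast
    qed
    have attracted0: "\<exists>p\<in>{0, 1}. x \<in> attracting_basin f (forward_orbit f p)"
      if "x \<in> z3_coset 0 1" for x
      using that by (simp add: orbit0 basin0)
    have attracted2: "(\<exists>p\<in>{0, 1}. x \<in> attracting_basin f (forward_orbit f p)) \<or>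
        (\<exists>i\<in>UNIV \<times> ?A. x \<in> attracting_basin f ((\<lambda>(l, a). M_comp 1 t l a) i))"
      if "x \<in> z3_coset 2 1" for x
    \<comment> \<open>After one step the point is either the fixed point 1, as happens for -1, or
      inside a component.\<close>
    proof (cases "f x = 1")
      case True
      then have "x \<in> attracting_basin f {1}"
        using m0 by (intro attracting_basinI[of 1]) (simp_all add: assms(3))
      then show ?thesis by (simp add: orbit1)
    next
      case False
      with f_coset2[OF that] have "f x \<in> (\<Union>(l, a)\<in>UNIV \<times> ?A. M_comp 1 t l a)"
        unfolding pos.UN_M_comp by blast
      then obtain l a where "a \<in> ?A" "f x \<in> M_comp 1 t l a" by auto
      moreover have "closed (M_comp 1 t l a)" "f ` M_comp 1 t l a \<subseteq> M_comp 1 t l a"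
        using pos.minimal_component_M_comp by (simp_all add: minimal_component_def assms(3))
      ultimately have "x \<in> attracting_basin f (M_comp 1 t l a)" "a \<in> ?A"
        by (simp_all add: attracting_basinI[of 1])
      then show ?thesis by auto
    qed
    show "minimal_decomposition f {0, 1} (UNIV \<times> ?A) (\<lambda>(l, a). M_comp 1 t l a)
        ((z3_coset 0 1 - {0}) \<union> z3_coset 2 1)"
      unfolding minimal_decomposition_def pos.UN_M_comp
    proof (intro conjI)
      show "{0, 1} = periodic_points f"
        using periodic01 per0 per1 per2 z3_three_cosets by blast
      show "\<forall>i\<in>UNIV \<times> ?A. minimal_component f ((\<lambda>(l, a). M_comp 1 t l a) i)"
        using pos.minimal_component_M_comp by (auto simp: assms(3))
      show "\<forall>x\<in>(z3_coset 0 1 - {0}) \<union> z3_coset 2 1.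
          (\<exists>p\<in>{0, 1}. x \<in> attracting_basin f (forward_orbit f p)) \<or>
          (\<exists>i\<in>UNIV \<times> ?A. x \<in> attracting_basin f ((\<lambda>(l, a). M_comp 1 t l a) i))"
        using attracted0 attracted2 by blast
    qed (use cosets in \<open>blast intro: countableI_type pos.disjoint_family_M_comp\<close>)+
  qed
  have odd_case: "minimal_decomposition f {0, 1, - 1} (UNIV \<times> ?A \<times> {1, 2})
      (\<lambda>(l, a, i). if i = (1::nat) then M_comp 1 t l a else M_comp (- 1) t l a)
      (z3_coset 0 1 - {0})" (is "minimal_decomposition f ?P ?I ?M ?B") if "odd m"
  proof -
    \<comment> \<open>\<open>m\<close> odd makes -1 a fixed point, so the local results apply there
      too.\<close>
    interpret neg: three_adic_power_sign m t "- 1"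
      by standard (use that in auto)
    have UN: "(\<Union>i\<in>?I. ?M i) = (z3_coset 1 1 - {1}) \<union> (z3_coset 2 1 - {- 1})"
      unfolding pos.UN_M_comp [symmetric] neg.UN_M_comp [symmetric] z3_coset_minus_one [symmetric]
      by force
    have "- 1 \<in> periodic_points f"
      by (rule fixed_point_periodic) (use that assms(3) in simp)
    moreover have "x = - 1" if "x \<in> periodic_points f" "x \<in> z3_coset 2 1" for x
      using neg.periodic_eq_sign that unfolding z3_coset_minus_one [symmetric]
      by (simp add: assms(3) z3_coset_iff)
    ultimately have periodic: "?P = periodic_points f"
      using periodic01 per0 per1 z3_three_cosets by blast
    \<comment> \<open>Components around 1 and around -1 are separated by their residues modulo
      3.\<close>
    have "M_comp 1 t l a \<subseteq> z3_coset 1 1" "M_comp (- 1) t l a \<subseteq> z3_coset (- 1) 1" for l a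
      using M_comp_cong_sign[of 1 t _ l a] M_comp_cong_sign[of "- 1" t _ l a] t_pos
      by (auto simp: z3_coset_iff)
    then have cross: "M_comp 1 t l a \<inter> M_comp (- 1) t l' b = {}" for l a l' b
      using z3_cosets_disjoint(3) unfolding z3_coset_minus_one by blast
    have disj: "disjoint_family_on ?M ?I"
      unfolding disjoint_family_on_def
    proof (intro ballI impI)
      fix p q assume "p \<in> ?I" "q \<in> ?I" "p \<noteq> q"
      moreover obtain l a i l' b j where "p = (l, a, i)" "q = (l', b, j)" by (cases p, cases q)
      ultimately have ij: "i = 1 \<or> i = 2" "j = 1 \<or> j = 2"
        and ab: "a \<le> 3 ^ (t - 1) - 1" "b \<le> 3 ^ (t - 1) - 1"
        and neq: "i = j \<Longrightarrow> \<not> (l = l' \<and> a = b)"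
        and pq: "p = (l, a, i)" "q = (l', b, j)" by auto
      have "M_comp 1 t l a \<inter> M_comp 1 t l' b = {}" "M_comp (- 1) t l a \<inter> M_comp (- 1) t l' b = {}"
        if "i = j"
        using pos.M_comp_disjoint[OF _ _ ab] neg.M_comp_disjoint[OF _ _ ab] neq[OF that] by blast+
      then show "?M p \<inter> ?M q = {}"
        using ij cross[of l a l' b] cross[of l' b l a] by (auto simp: pq Int_commute)
    qed
    show ?thesis
      unfolding minimal_decomposition_def UN
    proof (intro conjI)
      show "\<forall>i\<in>?I. minimal_component f (?M i)"
        using pos.minimal_component_M_comp neg.minimal_component_M_comp by (auto simp: assms(3))
      show "\<forall>x\<in>?B. (\<exists>p\<in>?P. x \<in> attracting_basin f (forward_orbit f p)) \<or>
          (\<exists>i\<in>?I. x \<in> attracting_basin f (?M i))"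
        by (simp add: orbit0 basin0)
      show "UNIV = ?P \<union> ((z3_coset 1 1 - {1}) \<union> (z3_coset 2 1 - {- 1})) \<union> ?B"
        using z3_three_cosets by blast
      show "?P \<inter> ((z3_coset 1 1 - {1}) \<union> (z3_coset 2 1 - {- 1})) = {}"
        "((z3_coset 1 1 - {1}) \<union> (z3_coset 2 1 - {- 1})) \<inter> ?B = {}" "?P \<inter> ?B = {}"
        using cosets by blast+
    qed (rule countableI_type periodic disj)+
  qed
  have "even m" if "[m = 2] (mod 6)"
    using that unfolding cong_def by presburger
  moreover have "odd m" if "[m = 5] (mod 6)"
    using that unfolding cong_def by presburger
  ultimately show ?thesis
    using even_case odd_case m0 unfolding basin0 by (auto simp: assms(3))
qed

end
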